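(* Let $n\ge2$ and let $u:\mathbb{R}^n\to\mathbb{R}$ be a harmonic function. If $u$ is not a homogeneous harmonic polynomial, then the function $R\mapsto\mu_u(R)$ is strictly monotonically increasing on $(0,\infty)$.
   Context: $\mathbb{R}^n$ carries the Euclidean metric; $B_R$ and $S_R$ denote the ball and sphere of radius $R$ centered at the origin, $d\mu$ is Lebesgue measure and $d\sigma$ the surface measure on spheres. For a harmonic function $u$ on $\mathbb{R}^n$, not identically zero, and $R>0$, define $$\mu_u(R)=\frac{2\int_0^R\int_{B_r}|\nabla u|^2\,d\mu\,dr}{\int_{S_R}u^2\,d\sigma}.$$ The zero function is regarded as a homogeneous harmonic polynomial. *)

theory Defs
  imports "HOL-Analysis.Analysis"
begin

definition gradient :: "(real ^ 'n \<Rightarrow> real) \<Rightarrow> real ^ 'n \<Rightarrow> real ^ 'n" where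
  "gradient f x = (\<chi> i. frechet_derivative f (at x) (axis i 1))"

definition second_partial :: "(real ^ 'n \<Rightarrow> real) \<Rightarrow> 'n \<Rightarrow> 'n \<Rightarrow> real ^ 'n \<Rightarrow> real" where
  "second_partial f i j x = gradient (\<lambda>y. gradient f y $ i) x $ j"

definition C2 :: "(real ^ 'n \<Rightarrow> real) \<Rightarrow> bool" where
  "C2 f \<longleftrightarrow>
     (\<forall>x. f differentiable (at x)) \<and>
     (\<forall>i x. (\<lambda>y. gradient f y $ i) differentiable (at x)) \<and>
     (\<forall>i j. continuous_on UNIV (second_partial f i j))"

definition laplacian :: "(real ^ 'n \<Rightarrow> real) \<Rightarrow> real ^ 'n \<Rightarrow> real" where
  "laplacian f x = (\<Sum>i\<in>UNIV. second_partial f i i x)"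

definition harmonic :: "(real ^ 'n \<Rightarrow> real) \<Rightarrow> bool" where
  "harmonic f \<longleftrightarrow> C2 f \<and> (\<forall>x. laplacian f x = 0)"

text \<open>The zero function is homogeneous (of every degree), with all coefficients zero.\<close>

definition homogeneous_polynomial :: "(real ^ 'n \<Rightarrow> real) \<Rightarrow> bool" where
  "homogeneous_polynomial p \<longleftrightarrow>
     (\<exists>(d::nat) (c :: ('n \<Rightarrow> nat) \<Rightarrow> real). \<forall>x.
        p x = (\<Sum>\<alpha> | (\<Sum>i\<in>UNIV. \<alpha> i) = d. c \<alpha> * (\<Prod>i\<in>UNIV. (x $ i) ^ \<alpha> i)))"

text \<open>Surface measure on the sphere of radius \<open>R > 0\<close>: the cone with apex \<open>0\<close> over a Borel
  set \<open>A\<close> of the sphere has volume \<open>R / n\<close> times the area of \<open>A\<close>. Pushing Lebesgue measure on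
  the punctured ball forward along the radial projection assigns to \<open>A\<close> the volume of this cone,
  so the surface measure is the push-forward scaled by \<open>n / R\<close>;
  see \<open>emeasure_surface_measure\<close>.\<close>

definition surface_measure :: "real \<Rightarrow> (real ^ 'n) measure" where
  "surface_measure R =
     scale_measure (ennreal (real CARD('n) / R))
       (distr (restrict_space lborel (ball 0 R - {0})) (restrict_space borel (sphere 0 R))
          (\<lambda>x. (R / norm x) *\<^sub>R x))"

lemma radial_projection_measurable:
  fixes R :: real
  assumes "R > 0"
  shows "(\<lambda>x :: real ^ 'n. (R / norm x) *\<^sub>R x) \<in>
    restrict_space lborel (ball 0 R - {0}) \<rightarrow>\<^sub>M restrict_space borel (sphere 0 R)"
proof (rule measurable_restrict_space2)
  show "(\<lambda>x :: real ^ 'n. (R / norm x) *\<^sub>R x) \<in> space (restrict_space lborel (ball 0 R - {0})) \<rightarrow> sphere 0 R"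
    using assms by (auto simp: space_restrict_space)
  show "(\<lambda>x :: real ^ 'n. (R / norm x) *\<^sub>R x) \<in> restrict_space lborel (ball 0 R - {0}) \<rightarrow>\<^sub>M borel"
    by (rule measurable_restrict_space1) measurable
qed

lemma emeasure_surface_measure:
  fixes A :: "(real ^ 'n) set"
  assumes "R > 0" and "A \<in> sets borel" and "A \<subseteq> sphere 0 R"
  shows "emeasure (surface_measure R) A =
    ennreal (real CARD('n) / R) * emeasure lborel {t *\<^sub>R x | t x. 0 < t \<and> t < 1 \<and> x \<in> A}"
proof -
  let ?f = "\<lambda>x :: real ^ 'n. (R / norm x) *\<^sub>R x"
  have A: "A \<in> sets (restrict_space borel (sphere 0 R))"
    using assms by (auto simp: sets_restrict_space)
  have norm_A: "norm x = R" if "x \<in> A" for x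
    using assms(3) that by auto
  have "?f -` A \<inter> (ball 0 R - {0}) = {t *\<^sub>R x | t x. 0 < t \<and> t < 1 \<and> x \<in> A}" (is "?L = ?C")
  proof (intro equalityI subsetI)
    fix y assume "y \<in> ?L"
    hence y: "?f y \<in> A" "norm y < R" "y \<noteq> 0"
      by auto
    have "y = (norm y / R) *\<^sub>R ?f y" "0 < norm y / R" "norm y / R < 1"
      using y assms(1) by auto
    thus "y \<in> ?C"
      using y(1) by blast
  next
    fix y assume "y \<in> ?C"
    then obtain t x where "y = t *\<^sub>R x" "0 < t" "t < 1" "x \<in> A"
      by blast
    thus "y \<in> ?L"
      using norm_A[of x] assms(1) by auto
  qed
  moreover have "?C \<subseteq> ball 0 R - {0}"
    using calculation by blast
  hence "emeasure (restrict_space lborel (ball 0 R - {0})) ?C = emeasure lborel ?C"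
    by (intro emeasure_restrict_space) auto
  ultimately show ?thesis
    unfolding surface_measure_def emeasure_scale_measure
    by (subst emeasure_distr[OF radial_projection_measurable[OF assms(1)] A])
       (simp add: space_restrict_space)
qed

definition growth_ratio :: "(real ^ 'n \<Rightarrow> real) \<Rightarrow> real \<Rightarrow> real" where
  "growth_ratio u R =
     2 * (LINT r:{0..R}|lborel. (LINT x:ball 0 r|lborel. (norm (gradient u x))\<^sup>2))
       / (LINT x|surface_measure R. (u x)\<^sup>2)"

end

theory Submission
  imports Defs
begin

text \<open>Write \<open>m(r)\<close> for the mean of \<open>u\<^sup>2\<close> over the sphere of radius \<open>r\<close>, up to a constant factor. Green's first
  identity says that the energy \<open>\<integral>|\<nabla>u|\<^sup>2\<close> over the ball of radius \<open>r\<close> is a multiple of \<open>r\<^sup>n\<^sup>-\<^sup>1 m'(r)\<close>;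
  integrating by parts, the growth ratio equals \<open>1 - (n - 1) \<integral>\<^sub>0\<^sup>1 s\<^sup>n\<^sup>-\<^sup>2 m(s R) / m(R) ds\<close>. So it suffices that
  \<open>m(s R) / m(R)\<close> decreases in \<open>R\<close>, that is, that \<open>ln m(e\<^sup>t)\<close> is convex.

  By Green's second identity the integral of \<open>u(r y) u(s y)\<close> over the unit sphere depends only on the
  product \<open>r s\<close>, so it equals \<open>m(\<surd>(r s))\<close>, and the Cauchy--Schwarz inequality gives
  \<open>m(\<surd>(r s))\<^sup>2 \<le> m(r) m(s)\<close>. In the case of equality with \<open>r < s\<close>, \<open>u(r y) = c u(s y)\<close> on the unit sphere,
  hence everywhere, so \<open>u(q x) = C u(x)\<close> with \<open>q = s / r > 1\<close>. Every partial derivative of \<open>u\<close> is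
  harmonic and satisfies the same relation with \<open>C / q\<close> in place of \<open>C\<close>, and for \<open>C \<le> 1\<close> such a function is
  constant; by induction \<open>u\<close> is a homogeneous polynomial.\<close>

text \<open>Sphere integrals are handled as ball integrals: \<open>cone_measure\<close> pushes
  Lebesgue measure on the unit ball forward by \<open>sgn\<close>. Green's identities then come from
  the weight \<open>max 0 (r\<^sup>2 - (norm x)\<^sup>2)\<close>: it vanishes on the sphere, so
  integration by parts over the whole space leaves no boundary term, and differentiating the result
  in r recovers the sphere. Two circularities shape the order. Logarithms and quotients of m need m
  > 0, but this positivity is itself drawn from the midpoint inequality, which therefore has to
  allow m = 0. The induction over partial derivatives needs them to be C2 again, while
  \<open>harmonic\<close> grants only two derivatives of u; the mean value property repairs this,
  and it is the two-radius pairing of u with the constant 1. Equality is analysed only for a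
  midpoint, so strictness is known at a single s; since the integrand is continuous in s, this is
  enough. The bound n >= 2 makes the factor n - 1 positive and kills the boundary term at radius
  0.\<close>

section \<open>Differentiation under the integral sign\<close>

text \<open>Dominated convergence for difference quotients. The Lipschitz bound is asked only
  against the base point and differentiability only at almost every y, because the truncated weights
  used later have a kink on a sphere.\<close>

lemma has_derivative_integral_dominated:
  fixes f :: "'a::euclidean_space \<Rightarrow> 'b \<Rightarrow> real" and f' :: "'b \<Rightarrow> 'a"
  assumes "e > 0"
    and f: "\<And>z. z \<in> ball x e \<Longrightarrow> integrable M (f z)"
    and w: "integrable M w" and f': "integrable M f'"
    and lip: "\<And>z. z \<in> ball x e \<Longrightarrow> AE y in M. \<bar>f z y - f x y\<bar> \<le> w y * norm (z - x)"
    and der: "AE y in M. ((\<lambda>z. f z y) has_derivative (\<lambda>h. f' y \<bullet> h)) (at x)"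
  shows "((\<lambda>z. \<integral>y. f z y \<partial>M) has_derivative (\<lambda>h. (\<integral>y. f' y \<partial>M) \<bullet> h)) (at x)"
  unfolding has_derivative_iff_norm
proof (intro conjI bounded_linear_inner_right)
  define q where "q = (\<lambda>z y. \<bar>f z y - f x y - f' y \<bullet> (z - x)\<bar> / norm (z - x))"
  define Q where "Q = (\<lambda>z. norm ((\<integral>y. f z y \<partial>M) - (\<integral>y. f x y \<partial>M) - (\<integral>y. f' y \<partial>M) \<bullet> (z - x)) / norm (z - x))"
  have x: "x \<in> ball x e" using \<open>e > 0\<close> by simp
  have "(Q \<longlongrightarrow> 0) (at x)"
    unfolding tendsto_at_iff_sequentially
  proof (intro allI impI)
    fix X :: "nat \<Rightarrow> 'a"
    assume X: "\<forall>i. X i \<in> UNIV - {x}" "X \<longlonglongrightarrow> x"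
    \<comment> \<open>Dominated convergence wants its bound for every index. The finitely many terms
      outside the ball are replaced by x, where \<open>q\<close> and \<open>Q\<close> are 0 because
      division by 0 gives 0.\<close>
    define Y where "Y = (\<lambda>i. if X i \<in> ball x e then X i else x)"
    have evY: "\<forall>\<^sub>F i in sequentially. Y i = X i"
      using X(2)[unfolded tendsto_iff, rule_format, OF \<open>e > 0\<close>]
      by eventually_elim (auto simp: Y_def dist_commute)
    have Yb: "Y i \<in> ball x e" for i
      using x by (auto simp: Y_def)
    have int: "integrable M (q (Y i))" for i
      unfolding q_def using f[OF Yb[of i]] f[OF x] f' by (auto intro!: integrable_abs)
    have lim: "(\<lambda>i. \<integral>y. q (Y i) y \<partial>M) \<longlonglongrightarrow> (\<integral>y. 0 \<partial>M)"
    proof (rule integral_dominated_convergence[where w = "\<lambda>y. \<bar>w y\<bar> + norm (f' y)"])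
      show "(\<lambda>y. 0::real) \<in> borel_measurable M" by simp
      show "q (Y i) \<in> borel_measurable M" for i using int by auto
      show "integrable M (\<lambda>y. \<bar>w y\<bar> + norm (f' y))"
        using w f' by auto
      show "AE y in M. (\<lambda>i. q (Y i) y) \<longlonglongrightarrow> 0"
        using der
      proof eventually_elim
        case (elim y)
        then have "((\<lambda>z. q z y) \<longlongrightarrow> 0) (at x)"
          by (simp add: has_derivative_iff_norm q_def)
        then have "(\<lambda>i. q (X i) y) \<longlonglongrightarrow> 0"
          using X unfolding tendsto_at_iff_sequentially by (simp add: o_def)
        moreover have "\<forall>\<^sub>F i in sequentially. q (X i) y = q (Y i) y"
          using evY by eventually_elim simp
        ultimately show ?case
          by (rule Lim_transform_eventually)
      qed
      show "AE y in M. norm (q (Y i) y) \<le> \<bar>w y\<bar> + norm (f' y)" for i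
        using lip[OF Yb[of i]]
      proof eventually_elim
        case (elim y)
        show ?case
        proof (cases "Y i = x")
          case False
          have "\<bar>f (Y i) y - f x y - f' y \<bullet> (Y i - x)\<bar> \<le> \<bar>f (Y i) y - f x y\<bar> + \<bar>f' y \<bullet> (Y i - x)\<bar>"
            by linarith
          also have "\<dots> \<le> \<bar>w y\<bar> * norm (Y i - x) + norm (f' y) * norm (Y i - x)"
            using elim Cauchy_Schwarz_ineq2[of "f' y" "Y i - x"]
              mult_right_mono[OF abs_ge_self[of "w y"], of "norm (Y i - x)"] by simp
          finally show ?thesis
            using False by (simp add: q_def divide_simps algebra_simps)
        qed (simp add: q_def)
      qed
    qed
    have "(\<lambda>i. Q (Y i)) \<longlonglongrightarrow> 0"
    proof (rule tendsto_0_le[where K = 1])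
      show "(\<lambda>i. \<integral>y. q (Y i) y \<partial>M) \<longlonglongrightarrow> 0" using lim by simp
      show "\<forall>\<^sub>F i in sequentially. norm (Q (Y i)) \<le> norm (\<integral>y. q (Y i) y \<partial>M) * 1"
      proof (intro always_eventually allI)
        fix i
        have i1: "integrable M (\<lambda>y. f' y \<bullet> (Y i - x))" using f' by simp
        have "(\<integral>y. f (Y i) y \<partial>M) - (\<integral>y. f x y \<partial>M) - (\<integral>y. f' y \<partial>M) \<bullet> (Y i - x)
            = (\<integral>y. f (Y i) y - f x y - f' y \<bullet> (Y i - x) \<partial>M)"
          using f[OF Yb[of i]] f[OF x] f' i1 by simp
        also have "\<bar>\<dots>\<bar> \<le> (\<integral>y. \<bar>f (Y i) y - f x y - f' y \<bullet> (Y i - x)\<bar> \<partial>M)"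
          by (rule integral_abs_bound)
        finally have "Q (Y i) \<le> (\<integral>y. q (Y i) y \<partial>M)"
          unfolding Q_def q_def by (simp add: divide_right_mono)
        moreover have "0 \<le> Q (Y i)" by (simp add: Q_def)
        ultimately show "norm (Q (Y i)) \<le> norm (\<integral>y. q (Y i) y \<partial>M) * 1" by simp
      qed
    qed
    moreover have "\<forall>\<^sub>F i in sequentially. Q (Y i) = Q (X i)"
      using evY by eventually_elim simp
    ultimately show "(Q \<circ> X) \<longlonglongrightarrow> 0"
      unfolding o_def by (rule Lim_transform_eventually)
  qed
  then show "((\<lambda>z. norm ((\<integral>y. f z y \<partial>M) - (\<integral>y. f x y \<partial>M) - (\<integral>y. f' y \<partial>M) \<bullet> (z - x)) / norm (z - x)) \<longlongrightarrow> 0) (at x)"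
    by (simp add: Q_def)
qed

text \<open>The common ground of \<open>ball_measure\<close> and \<open>cone_measure\<close>: for a
  finite measure concentrated on a compact set every continuous integrand is bounded almost
  everywhere, so integrals with a parameter are continuous or differentiable without separate
  majorants.\<close>

locale unit_ball_supported = finite_measure M for M :: "'b::euclidean_space measure" +
  assumes sets_eq_borel [measurable_cong]: "sets M = sets borel"
    and AE_norm_le_1: "AE y in M. norm y \<le> 1"
begin

lemma integrable_continuous:
  fixes f :: "'b \<Rightarrow> 'c::euclidean_space"
  assumes "continuous_on UNIV f"
  shows "integrable M f"
proof -
  have "compact (f ` cball 0 1)"
    using assms by (intro compact_continuous_image) (auto intro: continuous_on_subset)
  then obtain B where B: "\<And>y. norm y \<le> 1 \<Longrightarrow> norm (f y) \<le> B"
    by (force dest!: compact_imp_bounded simp: bounded_iff)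
  have [measurable]: "f \<in> borel_measurable borel"
    using assms by (rule borel_measurable_continuous_onI)
  show ?thesis
    by (rule integrable_const_bound[where B = B]) (use AE_norm_le_1 B in \<open>auto elim: eventually_mono\<close>)
qed

lemma continuous_section:
  assumes "continuous_on UNIV (\<lambda>(z, y). f z y)"
  shows "continuous_on UNIV (f z)"
proof -
  have "continuous_on UNIV (\<lambda>y. (z, y))"
    by (intro continuous_intros)
  from continuous_on_compose2[OF assms this] show ?thesis by simp
qed

lemma bounded_section:
  fixes f :: "'a::euclidean_space \<Rightarrow> 'b \<Rightarrow> 'c::euclidean_space"
  assumes "continuous_on UNIV (\<lambda>(z, y). f z y)"
  obtains B where "B > 0" "\<And>z y. norm z \<le> r \<Longrightarrow> norm y \<le> 1 \<Longrightarrow> norm (f z y) \<le> B"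
proof -
  have "compact ((\<lambda>(z, y). f z y) ` (cball 0 r \<times> cball 0 1))"
    using assms by (intro compact_continuous_image compact_Times) (auto intro: continuous_on_subset)
  then obtain B where "B > 0" "\<And>p. p \<in> cball 0 r \<times> cball 0 1 \<Longrightarrow> norm ((\<lambda>(z, y). f z y) p) \<le> B"
    by (force dest!: compact_imp_bounded simp: bounded_pos)
  then show ?thesis by (intro that[of B]) auto
qed

lemma continuous_on_integral:
  fixes f :: "'a::euclidean_space \<Rightarrow> 'b \<Rightarrow> 'c::euclidean_space"
  assumes "continuous_on UNIV (\<lambda>(z, y). f z y)"
  shows "continuous_on UNIV (\<lambda>z. \<integral>y. f z y \<partial>M)"
  unfolding continuous_on_sequentially
proof (intro allI ballI impI)
  fix X :: "nat \<Rightarrow> 'a" and a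
  assume "(\<forall>n. X n \<in> UNIV) \<and> X \<longlonglongrightarrow> a"
  then have X: "X \<longlonglongrightarrow> a" by simp
  then obtain r where r: "\<And>n. norm (X n) \<le> r"
    using convergent_imp_Bseq[OF convergentI] BseqE by metis
  obtain B where B: "B > 0" "\<And>z y. norm z \<le> r \<Longrightarrow> norm y \<le> 1 \<Longrightarrow> norm (f z y) \<le> B"
    using bounded_section[OF assms] by metis
  show "((\<lambda>z. \<integral>y. f z y \<partial>M) \<circ> X) \<longlonglongrightarrow> (\<integral>y. f a y \<partial>M)"
    unfolding o_def
  proof (rule integral_dominated_convergence[where w = "\<lambda>_. B"])
    show "f a \<in> borel_measurable M" "\<And>i. f (X i) \<in> borel_measurable M"
      using integrable_continuous[OF continuous_section[OF assms]] by auto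
    have "(\<lambda>i. (\<lambda>(z, y). f z y) (X i, y)) \<longlonglongrightarrow> (\<lambda>(z, y). f z y) (a, y)" for y
      using continuous_on_tendsto_compose[OF assms tendsto_Pair[OF X tendsto_const]] by simp
    then show "AE y in M. (\<lambda>i. f (X i) y) \<longlonglongrightarrow> f a y" by simp
    show "AE y in M. norm (f (X i) y) \<le> B" for i
      using AE_norm_le_1 by eventually_elim (use B r in auto)
  qed auto
qed

lemma has_derivative_integral:
  fixes f :: "'a::euclidean_space \<Rightarrow> 'b \<Rightarrow> real"
  assumes f: "\<And>z. continuous_on UNIV (f z)"
    and der: "\<And>z y. ((\<lambda>z. f z y) has_derivative (\<lambda>h. f' z y \<bullet> h)) (at z)"
    and f': "continuous_on UNIV (\<lambda>(z, y). f' z y)"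
  shows "((\<lambda>z. \<integral>y. f z y \<partial>M) has_derivative (\<lambda>h. (\<integral>y. f' x y \<partial>M) \<bullet> h)) (at x)"
proof -
  obtain B where B: "B > 0" "\<And>z y. norm z \<le> norm x + 1 \<Longrightarrow> norm y \<le> 1 \<Longrightarrow> norm (f' z y) \<le> B"
    using bounded_section[OF f'] by metis
  show ?thesis
  proof (rule has_derivative_integral_dominated[where e = 1 and w = "\<lambda>_. B"])
    show "integrable M (f z)" for z by (rule integrable_continuous[OF f])
    show "integrable M (f' x)" by (rule integrable_continuous[OF continuous_section[OF f']])
    show "AE y in M. \<bar>f z y - f x y\<bar> \<le> B * norm (z - x)" if z: "z \<in> ball x 1" for z
      using AE_norm_le_1
    proof eventually_elim
      case (elim y)
      have "norm (f z y - f x y) \<le> B * norm (z - x)"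
      proof (rule differentiable_bound[where S = "ball x 1" and f' = "\<lambda>z h. f' z y \<bullet> h"])
        show "((\<lambda>z. f z y) has_derivative (\<bullet>) (f' t y)) (at t within ball x 1)" for t
          using der by (rule has_derivative_at_withinI)
        fix t assume "t \<in> ball x 1"
        then have "norm t \<le> norm x + 1"
          using norm_triangle_sub[of t x] by (auto simp: dist_norm norm_minus_commute)
        then show "onorm ((\<bullet>) (f' t y)) \<le> B"
          using B(2)[OF _ elim, of t]
          by (intro onorm_le) (metis Cauchy_Schwarz_ineq2 mult_right_mono norm_ge_zero order_trans real_norm_def)
      qed (use z in auto)
      then show ?case by simp
    qed
    show "AE y in M. ((\<lambda>z. f z y) has_derivative (\<bullet>) (f' x y)) (at x)" using der by simp
  qed auto
qed

end

section \<open>Integrals over balls and spheres\<close>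

lemma has_derivative_inner_real_iff:
  "(f has_derivative (\<lambda>h. c \<bullet> h)) F \<longleftrightarrow> (f has_real_derivative c) F"
  by (simp add: has_field_derivative_def inner_real_def[abs_def])

lemma integrable_vanishing_outside:
  fixes f :: "'a::euclidean_space \<Rightarrow> 'b::euclidean_space"
  assumes [measurable]: "f \<in> borel_measurable borel"
    and B: "\<And>x. x \<in> cball 0 r \<Longrightarrow> norm (f x) \<le> B"
    and out: "\<And>x. x \<notin> cball 0 r \<Longrightarrow> f x = 0"
  shows "integrable lborel f"
proof (rule Bochner_Integration.integrable_bound)
  show "integrable lborel (\<lambda>x::'a. B * indicator (cball 0 r) x)"
    using emeasure_lborel_cball_finite[of "0::'a" r] by (intro integrable_mult_right integrable_real_indicator) auto
  show "AE x in lborel. norm (f x) \<le> norm (B * indicator (cball 0 r) x)"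
    using B out by (intro AE_I2) (fastforce simp: indicator_def)
qed simp

lemma bounded_on_cball:
  fixes f :: "'a::euclidean_space \<Rightarrow> 'b::euclidean_space"
  assumes "continuous_on UNIV f"
  obtains B where "B > 0" "\<And>x. norm x \<le> r \<Longrightarrow> norm (f x) \<le> B"
proof -
  have "compact (f ` cball 0 r)"
    using assms by (intro compact_continuous_image) (auto intro: continuous_on_subset)
  then show ?thesis
    using that by (force dest!: compact_imp_bounded simp: bounded_pos)
qed

lemma set_integrable_bounded:
  fixes f :: "'a::euclidean_space \<Rightarrow> 'b::euclidean_space"
  assumes [measurable]: "f \<in> borel_measurable borel"
    and "A \<in> sets borel" "A \<subseteq> cball 0 r"
    and B: "\<And>x. norm x \<le> r \<Longrightarrow> norm (f x) \<le> B"
  shows "set_integrable lborel A f"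
  unfolding set_integrable_def
proof (rule integrable_vanishing_outside[where r = r and B = B])
  show "norm (indicator A x *\<^sub>R f x) \<le> B" if "x \<in> cball 0 r" for x
    using B[of x] that order_trans[OF norm_ge_zero B[of x]] by (auto simp: indicator_def)
qed (use assms in \<open>auto simp: indicator_def\<close>)

lemma set_integrable_continuous:
  fixes f :: "'a::euclidean_space \<Rightarrow> 'b::euclidean_space"
  assumes "continuous_on UNIV f" "A \<in> sets borel" "A \<subseteq> cball 0 r"
  shows "set_integrable lborel A f"
  using bounded_on_cball[OF assms(1)] set_integrable_bounded[OF _ assms(2,3)]
    borel_measurable_continuous_onI[OF assms(1)] by metis

lemma ball_integral_scale:
  fixes f :: "'a::euclidean_space \<Rightarrow> real" and r :: real
  assumes [measurable]: "f \<in> borel_measurable borel" and "r > 0"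
  shows "(LINT x:ball 0 r|lborel. f x) = r ^ DIM('a) * (LINT x:ball 0 1|lborel. f (r *\<^sub>R x))"
proof -
  have ind: "indicator (ball 0 r) (r *\<^sub>R x) = (indicator (ball 0 1) x :: real)" for x :: 'a
    using \<open>r > 0\<close> by (simp add: indicator_def)
  have m: "(\<lambda>x. indicator (ball 0 r) x * f x) \<in> borel_measurable borel"
    using assms(1) by (intro borel_measurable_times borel_measurable_indicator) auto
  have "(LINT x:ball 0 r|lborel. f x)
      = (LINT x|density (distr lborel borel (\<lambda>x. 0 + r *\<^sub>R x)) (\<lambda>_. ennreal (\<bar>r\<bar> ^ DIM('a))). indicator (ball 0 r) x * f x)"
    unfolding set_lebesgue_integral_def using lborel_affine[of r "0::'a"] \<open>r > 0\<close> by simp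
  also have "\<dots> = (LINT x|lborel. \<bar>r\<bar> ^ DIM('a) * (indicator (ball 0 r) (r *\<^sub>R x) * f (r *\<^sub>R x)))"
    by (subst integral_density) (auto intro!: m simp: integral_distr[OF _ m])
  also have "\<dots> = r ^ DIM('a) * (LINT x:ball 0 1|lborel. f (r *\<^sub>R x))"
    unfolding set_lebesgue_integral_def ind using \<open>r > 0\<close> by simp
  finally show ?thesis .
qed

text \<open>Up to the factor \<open>n\<close>, \<open>cone_measure\<close> is the surface measure of the unit sphere.\<close>

definition ball_measure :: "'a::euclidean_space measure" where
  "ball_measure = distr (restrict_space lborel (ball 0 1)) borel (\<lambda>x. x)"

definition cone_measure :: "'a::euclidean_space measure" where
  "cone_measure = distr (restrict_space lborel (ball 0 1)) borel sgn"

lemma measurable_sgn [measurable]: "sgn \<in> borel_measurable (borel :: 'a::euclidean_space measure)"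
  unfolding sgn_div_norm by measurable

lemma unit_ball_supported_distr:
  fixes g :: "'a::euclidean_space \<Rightarrow> 'b::euclidean_space"
  assumes [measurable]: "g \<in> borel_measurable borel" and g: "\<And>x. norm x < 1 \<Longrightarrow> norm (g x) \<le> 1"
  shows "unit_ball_supported (distr (restrict_space lborel (ball 0 1)) borel g)"
proof -
  have m: "g \<in> borel_measurable (restrict_space lborel (ball 0 1))"
    by (rule measurable_restrict_space1) measurable
  interpret R: finite_measure "restrict_space lborel (ball 0 1 :: 'a set)"
    by (rule finite_measureI) (use emeasure_lborel_ball_finite[of "0::'a" 1] in \<open>auto simp: space_restrict_space emeasure_restrict_space\<close>)
  show ?thesis
    using R.finite_measure_distr[OF m] g
    by (auto simp: unit_ball_supported_def unit_ball_supported_axioms_def AE_distr_iff[OF m]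
        AE_restrict_space_iff)
qed

interpretation ball_measure: unit_ball_supported "ball_measure :: 'a::euclidean_space measure"
  unfolding ball_measure_def by (rule unit_ball_supported_distr) auto

interpretation cone_measure: unit_ball_supported "cone_measure :: 'a::euclidean_space measure"
  unfolding cone_measure_def by (rule unit_ball_supported_distr) (auto simp: norm_sgn)

lemma integral_ball_measure:
  assumes "f \<in> borel_measurable borel"
  shows "(\<integral>x. f x \<partial>ball_measure) = (LINT x:ball 0 1|lborel. f x :: real)"
  unfolding ball_measure_def set_lebesgue_integral_def
  by (subst integral_distr) (use assms in \<open>auto intro!: measurable_restrict_space1 simp: integral_restrict_space\<close>)

lemma integral_cone_measure:
  assumes "f \<in> borel_measurable borel"
  shows "(\<integral>x. f x \<partial>cone_measure) = (LINT x:ball 0 1|lborel. f (sgn x) :: real)"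
  unfolding cone_measure_def set_lebesgue_integral_def
  by (subst integral_distr) (use assms in \<open>auto intro!: measurable_restrict_space1 simp: integral_restrict_space\<close>)

text \<open>Meant for a \<open>k\<close> that is small near one sphere: a thin shell has volume
  proportional to its width up to a bounded factor, so the difference quotient in the radius becomes
  as small as \<open>k\<close>.\<close>

lemma ball_integral_diff_le:
  fixes k :: "'a::euclidean_space \<Rightarrow> real"
  assumes k: "set_integrable lborel (ball 0 b) k" and "0 < a" "a \<le> b"
    and le: "\<And>x. a \<le> norm x \<Longrightarrow> norm x < b \<Longrightarrow> \<bar>k x\<bar> \<le> \<epsilon>"
  shows "\<bar>(LINT x:ball 0 b|lborel. k x) - (LINT x:ball 0 a|lborel. k x)\<bar>
    \<le> \<epsilon> * (unit_ball_vol (DIM('a)) * (b ^ DIM('a) - a ^ DIM('a)))"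
proof -
  let ?A = "ball 0 b - ball 0 a :: 'a set"
  have sub: "ball 0 a \<subseteq> (ball 0 b :: 'a set)" using \<open>a \<le> b\<close> by auto
  have k': "set_integrable lborel (ball 0 a) k" "set_integrable lborel ?A k"
    using k sub by (auto intro: set_integrable_subset)
  have fin: "emeasure lborel ?A < \<infinity>"
    using emeasure_mono[of ?A "ball 0 b" lborel] emeasure_lborel_ball_finite[of "0::'a" b] by auto
  have finb: "emeasure lborel (ball 0 b :: 'a set) \<noteq> \<infinity>"
    using emeasure_lborel_ball_finite[of "0::'a" b] by simp
  have meas: "measure lborel ?A = unit_ball_vol (DIM('a)) * (b ^ DIM('a) - a ^ DIM('a))"
    using measure_Diff[OF finb, of "ball 0 a"] sub assms(2,3)
    by (simp add: content_ball algebra_simps)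
  have int_const: "set_integrable lborel ?A (\<lambda>_. c::real)" for c
    unfolding set_integrable_def using fin by simp
  have val_const: "(LINT x:?A|lborel. c) = c * measure lborel ?A" for c :: real
    unfolding set_lebesgue_integral_def by simp
  have "(LINT x:ball 0 b|lborel. k x) = (LINT x:ball 0 a|lborel. k x) + (LINT x:?A|lborel. k x)"
    using set_integral_Un[OF _ k'] sub by (simp add: Un_absorb1)
  moreover have "(LINT x:?A|lborel. k x) \<le> (LINT x:?A|lborel. \<epsilon>)"
    using le by (intro set_integral_mono k' int_const) force
  moreover have "(LINT x:?A|lborel. -\<epsilon>) \<le> (LINT x:?A|lborel. k x)"
    using le by (intro set_integral_mono k' int_const) force
  ultimately show ?thesis
    unfolding val_const meas by (simp add: abs_le_iff)
qed

text \<open>Stands in for polar coordinates. Freezing \<open>f\<close> along rays at radius r gives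
  a function whose integral over the ball of radius \<open>\<rho>\<close> is exactly
  \<open>\<rho> ^ DIM('a) * c\<close>; the remainder \<open>k\<close> is uniformly small near the
  sphere of radius r, so its ball integral has derivative 0 there.\<close>

lemma ball_integral_has_derivative:
  fixes f :: "'a::euclidean_space \<Rightarrow> real" and r :: real
  assumes f: "continuous_on UNIV f" and "r > 0"
  shows "((\<lambda>r. LINT x:ball 0 r|lborel. f x) has_real_derivative
    DIM('a) * r ^ (DIM('a) - 1) * (\<integral>y. f (r *\<^sub>R y) \<partial>cone_measure)) (at r)"
proof -
  let ?D = "DIM('a)"
  define c where "c = (\<integral>y. f (r *\<^sub>R y) \<partial>cone_measure)"
  define k where "k = (\<lambda>x. f x - f (r *\<^sub>R sgn x))"
  define \<Delta> where "\<Delta> = (\<lambda>\<rho>. LINT x:ball 0 \<rho>|lborel. k x)"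
  define V where "V = unit_ball_vol (real ?D)"
  have V: "V \<ge> 0" by (simp add: V_def unit_ball_vol_def)
  have [measurable]: "f \<in> borel_measurable borel"
    using f by (rule borel_measurable_continuous_onI)
  have intf: "set_integrable lborel (ball 0 \<rho>) f" for \<rho>
    by (rule set_integrable_continuous[OF f _ ball_subset_cball]) simp
  obtain B where B: "\<And>x. norm x \<le> r \<Longrightarrow> norm (f x) \<le> B"
    using bounded_on_cball[OF f] by metis
  have ints: "set_integrable lborel (ball 0 \<rho>) (\<lambda>x. f (r *\<^sub>R sgn x))" for \<rho>
  proof (rule set_integrable_bounded[where r = \<rho> and B = B])
    show "norm (f (r *\<^sub>R sgn x)) \<le> B" for x
      using \<open>r > 0\<close> by (intro B) (simp add: norm_sgn)
  qed auto
  have intk: "set_integrable lborel (ball 0 \<rho>) k" for \<rho>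
    unfolding k_def using intf ints by (rule set_integral_diff)
  have cone: "(LINT x:ball 0 \<rho>|lborel. f (r *\<^sub>R sgn x)) = \<rho> ^ ?D * c" if "\<rho> > 0" for \<rho>
  proof -
    have "sgn (\<rho> *\<^sub>R x) = sgn x" for x :: 'a
      using that by (simp add: sgn_scaleR)
    then show ?thesis
      using ball_integral_scale[of "\<lambda>x. f (r *\<^sub>R sgn x)" \<rho>] that
      by (simp add: c_def integral_cone_measure)
  qed
  have split: "(LINT x:ball 0 \<rho>|lborel. f x) = \<Delta> \<rho> + \<rho> ^ ?D * c" if "\<rho> > 0" for \<rho>
    unfolding \<Delta>_def k_def using cone[OF that] set_integral_diff(2)[OF intf ints] by simp
  have pow: "((\<lambda>\<rho>. \<rho> ^ ?D) has_real_derivative ?D * r ^ (?D - 1)) (at r)"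
    by (auto intro!: derivative_eq_intros)
  have "(\<Delta> has_real_derivative 0) (at r)"
    unfolding has_field_derivative_iff
  proof (rule tendstoI)
    fix \<epsilon> :: real assume "\<epsilon> > 0"
    \<comment> \<open>Near r, \<open>L\<close> bounds V times the slope of the power function, with
      +1 as room for the limit. Dividing by L + 1 in \<open>\<eta>\<close> keeps
      \<open>\<eta> * L < \<epsilon>\<close> even for L = 0.\<close>
    define L where "L = V * (?D * r ^ (?D - 1) + 1)"
    have L: "L \<ge> 0" using V \<open>r > 0\<close> by (simp add: L_def)
    define \<eta> where "\<eta> = \<epsilon> / (L + 1)"
    have \<eta>: "\<eta> > 0" "\<eta> * L < \<epsilon>"
      using L \<open>\<epsilon> > 0\<close> by (auto simp: \<eta>_def field_simps)
    have "uniformly_continuous_on (cball 0 (2 * r)) f"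
      using f by (intro compact_uniformly_continuous) (auto intro: continuous_on_subset)
    then obtain d where d: "d > 0" "\<And>x y. norm x \<le> 2 * r \<Longrightarrow> norm y \<le> 2 * r \<Longrightarrow> norm (x - y) < d \<Longrightarrow> \<bar>f x - f y\<bar> < \<eta>"
      unfolding uniformly_continuous_on_def using \<eta>(1) by (force simp: dist_norm)
    define \<delta> where "\<delta> = min d r"
    have \<delta>: "\<delta> > 0" "\<delta> \<le> d" "\<delta> \<le> r" using d \<open>r > 0\<close> by (auto simp: \<delta>_def)
    have k: "\<bar>k x\<bar> \<le> \<eta>" if x: "\<bar>norm x - r\<bar> < \<delta>" for x
    proof -
      have "x \<noteq> 0" using x \<delta> by auto
      have "x = norm x *\<^sub>R sgn x" using \<open>x \<noteq> 0\<close> by (simp add: sgn_div_norm)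
      then have "x - r *\<^sub>R sgn x = (norm x - r) *\<^sub>R sgn x"
        by (metis scaleR_left_diff_distrib)
      then have "norm (x - r *\<^sub>R sgn x) < d"
        using x \<delta> \<open>x \<noteq> 0\<close> by (simp add: norm_sgn)
      then show ?thesis
        unfolding k_def using x \<delta> \<open>r > 0\<close> \<open>x \<noteq> 0\<close> by (intro less_imp_le d(2)) (auto simp: norm_sgn)
    qed
    have est: "\<bar>\<Delta> \<rho> - \<Delta> r\<bar> \<le> \<eta> * (V * \<bar>\<rho> ^ ?D - r ^ ?D\<bar>)" if \<rho>: "\<bar>\<rho> - r\<bar> < \<delta>" for \<rho>
    proof (cases "r \<le> \<rho>")
      case True
      have "\<bar>\<Delta> \<rho> - \<Delta> r\<bar> \<le> \<eta> * (V * (\<rho> ^ ?D - r ^ ?D))"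
        unfolding \<Delta>_def V_def
        by (rule ball_integral_diff_le[OF intk \<open>r > 0\<close> True]) (use k \<rho> in auto)
      then show ?thesis
        using power_mono[OF True, of ?D] \<open>r > 0\<close> by simp
    next
      case False
      have "\<bar>\<Delta> r - \<Delta> \<rho>\<bar> \<le> \<eta> * (V * (r ^ ?D - \<rho> ^ ?D))"
        unfolding \<Delta>_def V_def
        by (rule ball_integral_diff_le[OF intk]) (use k \<rho> \<delta> False in auto)
      then show ?thesis
        using power_mono[of \<rho> r ?D] False \<rho> \<delta> by (simp add: abs_minus_commute)
    qed
    have "\<forall>\<^sub>F \<rho> in at r. (\<rho> ^ ?D - r ^ ?D) / (\<rho> - r) < ?D * r ^ (?D - 1) + 1"
      using pow unfolding has_field_derivative_iff by (rule order_tendstoD) simp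
    moreover have "\<forall>\<^sub>F \<rho> in at r. (\<rho> ^ ?D - r ^ ?D) / (\<rho> - r) > - (?D * r ^ (?D - 1) + 1)"
      using pow unfolding has_field_derivative_iff
      by (rule order_tendstoD) (use \<open>r > 0\<close> in \<open>auto simp: add_pos_nonneg intro: less_le_trans[of _ 0]\<close>)
    moreover have "\<forall>\<^sub>F \<rho> in at r. \<rho> \<noteq> r \<and> dist \<rho> r < \<delta>"
      using \<delta>(1) by (auto simp: eventually_at)
    ultimately show "\<forall>\<^sub>F \<rho> in at r. dist ((\<Delta> \<rho> - \<Delta> r) / (\<rho> - r)) 0 < \<epsilon>"
    proof eventually_elim
      case (elim \<rho>)
      have q: "\<bar>\<rho> ^ ?D - r ^ ?D\<bar> / \<bar>\<rho> - r\<bar> \<le> ?D * r ^ (?D - 1) + 1"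
        using elim(1,2) by (simp add: abs_divide[symmetric] del: abs_divide)
      have "\<bar>\<Delta> \<rho> - \<Delta> r\<bar> / \<bar>\<rho> - r\<bar> \<le> \<eta> * (V * \<bar>\<rho> ^ ?D - r ^ ?D\<bar>) / \<bar>\<rho> - r\<bar>"
        using est[of \<rho>] elim by (intro divide_right_mono) (auto simp: dist_real_def)
      also have "\<dots> = \<eta> * V * (\<bar>\<rho> ^ ?D - r ^ ?D\<bar> / \<bar>\<rho> - r\<bar>)" by simp
      also have "\<dots> \<le> \<eta> * V * (?D * r ^ (?D - 1) + 1)"
        using q \<eta> V by (intro mult_left_mono) auto
      also have "\<dots> < \<epsilon>" using \<eta> by (simp add: L_def mult.assoc)
      finally show ?case by simp
    qed
  qed
  then have "((\<lambda>\<rho>. \<Delta> \<rho> + \<rho> ^ ?D * c) has_real_derivative ?D * r ^ (?D - 1) * c) (at r)"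
    using pow by (auto intro!: derivative_eq_intros)
  then show ?thesis
    unfolding c_def[symmetric]
    by (rule has_field_derivative_transform_within_open[where S = "{0<..}"]) (use \<open>r > 0\<close> split in auto)
qed

lemma AE_not_in_sphere: "AE x in lborel. x \<notin> sphere (a::'a::euclidean_space) r"
  using negligible_sphere[of a r]
  by (intro AE_not_in) (auto simp: null_sets_completion_iff negligible_iff_null_sets)

text \<open>The weight is Lipschitz in r and its kink, the sphere of radius r, is a null set; off it
  the derivative in r is 2 r inside the ball and 0 outside.\<close>

lemma weighted_integral_has_derivative:
  fixes f :: "'a::euclidean_space \<Rightarrow> real" and r :: real
  assumes f: "continuous_on UNIV f" and "r > 0"
  shows "((\<lambda>r. LINT x|lborel. max 0 (r\<^sup>2 - (norm x)\<^sup>2) * f x) has_real_derivative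
    2 * r * (LINT x:ball 0 r|lborel. f x)) (at r)"
proof -
  have [measurable]: "f \<in> borel_measurable borel"
    using f by (rule borel_measurable_continuous_onI)
  obtain B where B: "B > 0" "\<And>x. norm x \<le> r + 1 \<Longrightarrow> norm (f x) \<le> B"
    using bounded_on_cball[OF f] by metis
  define f' where "f' = (\<lambda>y. indicator (ball 0 r) y * (2 * r * f y))"
  \<comment> \<open>For |z - r| < 1 one has |z + r| <= 2 r + 1, which is the Lipschitz constant of
    the square; the cutoff at r + 1 covers the supports of all weights involved.\<close>
  define w where "w = (\<lambda>y::'a. indicator (cball 0 (r + 1)) y * ((2 * r + 1) * B))"
  have out: "max 0 (z\<^sup>2 - (norm y)\<^sup>2) = 0" if "\<bar>z\<bar> \<le> norm y" for z and y :: 'a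
    using that abs_le_square_iff[of z "norm y"] by simp
  have "((\<lambda>z. LINT y|lborel. max 0 (z\<^sup>2 - (norm y)\<^sup>2) * f y) has_derivative (\<lambda>h. (LINT y|lborel. f' y) \<bullet> h)) (at r)"
  proof (rule has_derivative_integral_dominated[where e = 1 and w = w])
    show "integrable lborel (\<lambda>y. max 0 (z\<^sup>2 - (norm y)\<^sup>2) * f y)" if z: "z \<in> ball r 1" for z
    proof (rule integrable_vanishing_outside[where r = "r + 1" and B = "z\<^sup>2 * B"])
      fix y :: 'a
      show "norm (max 0 (z\<^sup>2 - (norm y)\<^sup>2) * f y) \<le> z\<^sup>2 * B" if "y \<in> cball 0 (r + 1)"
        unfolding norm_mult using B(2)[of y] that by (intro mult_mono) auto
      show "max 0 (z\<^sup>2 - (norm y)\<^sup>2) * f y = 0" if "y \<notin> cball 0 (r + 1)"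
        using out[of z y] that z \<open>r > 0\<close> by (simp add: dist_real_def)
    qed simp
    show "integrable lborel w" unfolding w_def
      by (rule integrable_vanishing_outside[where r = "r + 1" and B = "(2 * r + 1) * B"])
        (use B \<open>r > 0\<close> in \<open>auto simp: indicator_def\<close>)
    show "integrable lborel f'" unfolding f'_def
    proof (rule integrable_vanishing_outside[where r = r and B = "2 * r * B"])
      show "norm (indicator (ball 0 r) y * (2 * r * f y)) \<le> 2 * r * B" for y
        using B \<open>r > 0\<close> by (auto simp: indicator_def abs_mult)
    qed (auto simp: indicator_def)
    show "AE y in lborel. \<bar>max 0 (z\<^sup>2 - (norm y)\<^sup>2) * f y - max 0 (r\<^sup>2 - (norm y)\<^sup>2) * f y\<bar> \<le> w y * norm (z - r)"
      if z: "z \<in> ball r 1" for z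
    proof (rule AE_I2)
      fix y :: 'a
      show "\<bar>max 0 (z\<^sup>2 - (norm y)\<^sup>2) * f y - max 0 (r\<^sup>2 - (norm y)\<^sup>2) * f y\<bar> \<le> w y * norm (z - r)"
      proof (cases "norm y \<le> r + 1")
        case True
        have "\<bar>max 0 (z\<^sup>2 - (norm y)\<^sup>2) - max 0 (r\<^sup>2 - (norm y)\<^sup>2)\<bar> \<le> \<bar>z\<^sup>2 - r\<^sup>2\<bar>" by linarith
        also have "\<dots> = \<bar>z + r\<bar> * \<bar>z - r\<bar>" by (simp add: power2_eq_square algebra_simps flip: abs_mult)
        also have "\<dots> \<le> (2 * r + 1) * \<bar>z - r\<bar>"
          using z \<open>r > 0\<close> by (intro mult_right_mono) (auto simp: dist_real_def)
        finally have "\<bar>max 0 (z\<^sup>2 - (norm y)\<^sup>2) - max 0 (r\<^sup>2 - (norm y)\<^sup>2)\<bar> * \<bar>f y\<bar> \<le> (2 * r + 1) * \<bar>z - r\<bar> * B"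
          using B(2)[OF True] \<open>r > 0\<close> by (intro mult_mono) auto
        then show ?thesis
          unfolding left_diff_distrib[symmetric] abs_mult using True by (simp add: w_def ac_simps)
      next
        case False
        then have "\<bar>z\<bar> \<le> norm y" "\<bar>r\<bar> \<le> norm y" using z \<open>r > 0\<close> by (auto simp: dist_real_def)
        then show ?thesis using out False by (simp add: w_def)
      qed
    qed
    show "AE y in lborel. ((\<lambda>z. max 0 (z\<^sup>2 - (norm y)\<^sup>2) * f y) has_derivative (\<bullet>) (f' y)) (at r)"
      using AE_not_in_sphere[of "0::'a" r]
    proof eventually_elim
      case (elim y)
      have "((\<lambda>z. max 0 (z\<^sup>2 - (norm y)\<^sup>2) * f y) has_real_derivative f' y) (at r)"
      proof (cases "norm y < r")
        case True
        have "((\<lambda>z. (z\<^sup>2 - (norm y)\<^sup>2) * f y) has_real_derivative f' y) (at r)"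
          using True by (auto intro!: derivative_eq_intros simp: f'_def)
        then show ?thesis
          by (rule has_field_derivative_transform_within_open[where S = "{norm y<..}"])
            (use True in \<open>auto intro!: power_mono max_absorb2[symmetric]\<close>)
      next
        case False
        with elim have "r < norm y" by auto
        have "((\<lambda>z. 0) has_real_derivative f' y) (at r)"
          using False by (simp add: f'_def)
        then show ?thesis
          by (rule has_field_derivative_transform_within_open[where S = "{-norm y<..<norm y}"])
            (use \<open>r < norm y\<close> \<open>r > 0\<close> out in \<open>auto simp: abs_le_iff\<close>)
      qed
      then show ?case
        by (simp only: has_derivative_inner_real_iff)
    qed
  qed auto
  moreover have "(LINT y|lborel. f' y) = 2 * r * (LINT x:ball 0 r|lborel. f x)"
    unfolding f'_def set_lebesgue_integral_def by (simp flip: integral_mult_right_zero add: mult.left_commute)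
  ultimately show ?thesis
    by (simp only: has_derivative_inner_real_iff)
qed

section \<open>The divergence theorem on balls\<close>

lemma lborel_integral_translation:
  fixes F :: "'a::euclidean_space \<Rightarrow> real"
  assumes "F \<in> borel_measurable borel"
  shows "(LINT y|lborel. F (a + y)) = (LINT y|lborel. F y)"
  by (subst (2) lborel_distr_plus[of a, symmetric], subst integral_distr) (use assms in auto)

text \<open>The integral of \<open>F(x + t v)\<close> over the whole space does not depend on \<open>t\<close>.\<close>

lemma integral_directional_derivative_eq_0:
  fixes F F' :: "'a::euclidean_space \<Rightarrow> real"
  assumes F: "continuous_on UNIV F" and out: "\<And>x. norm x > r \<Longrightarrow> F x = 0"
    and lip: "\<And>x t. \<bar>t\<bar> < 1 \<Longrightarrow> \<bar>F (x + t *\<^sub>R v) - F x\<bar> \<le> L * \<bar>t\<bar>"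
    and der: "AE x in lborel. ((\<lambda>t. F (x + t *\<^sub>R v)) has_real_derivative F' x) (at 0)"
    and F': "integrable lborel F'"
  shows "(LINT x|lborel. F' x) = 0"
proof -
  have [measurable]: "F \<in> borel_measurable borel"
    using F by (rule borel_measurable_continuous_onI)
  have L: "L \<ge> 0" using order_trans[OF abs_ge_zero lip[of "1/2" 0]] by simp
  obtain B where B: "\<And>x. norm x \<le> r \<Longrightarrow> norm (F x) \<le> B"
    using bounded_on_cball[OF F] by metis
  have intF: "integrable lborel F"
    by (rule integrable_vanishing_outside[where r = r and B = B]) (use B out in auto)
  define w where "w = (\<lambda>x::'a. indicator (cball 0 (r + norm v)) x * L)"
  have "((\<lambda>t. LINT x|lborel. F (x + t *\<^sub>R v)) has_derivative (\<lambda>h. (LINT x|lborel. F' x) \<bullet> h)) (at 0)"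
  proof (rule has_derivative_integral_dominated[where e = 1 and w = w])
    show "integrable lborel (\<lambda>x. F (x + t *\<^sub>R v))" for t
    proof -
      have "integrable (distr lborel borel ((+) (t *\<^sub>R v))) F"
        using intF by (simp add: lborel_distr_plus)
      then show ?thesis
        by (subst (asm) integrable_distr_eq) (auto simp: add.commute)
    qed
    show "integrable lborel w" unfolding w_def
      by (rule integrable_vanishing_outside[where r = "r + norm v" and B = L]) (use L in \<open>auto simp: indicator_def\<close>)
    show "AE x in lborel. \<bar>F (x + t *\<^sub>R v) - F (x + 0 *\<^sub>R v)\<bar> \<le> w x * norm (t - 0)" if t: "t \<in> ball 0 1" for t
    proof (rule AE_I2)
      fix x
      show "\<bar>F (x + t *\<^sub>R v) - F (x + 0 *\<^sub>R v)\<bar> \<le> w x * norm (t - 0)"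
      proof (cases "norm x \<le> r + norm v")
        case True
        then show ?thesis using lip[of t x] t by (simp add: w_def)
      next
        case False
        have "norm (t *\<^sub>R v) \<le> norm v"
          using t mult_right_mono[of "\<bar>t\<bar>" 1 "norm v"] by simp
        then have "norm (x + t *\<^sub>R v) > r" "norm x > r"
          using False norm_ge_zero[of v] norm_triangle_ineq4[of "x + t *\<^sub>R v" "t *\<^sub>R v"]
          unfolding add_diff_cancel_right' by linarith+
        then show ?thesis using out False by (simp add: w_def)
      qed
    qed
    show "AE x in lborel. ((\<lambda>t. F (x + t *\<^sub>R v)) has_derivative (\<bullet>) (F' x)) (at 0)"
      using der by (simp only: has_derivative_inner_real_iff)
  qed (use F' in auto)
  then have "((\<lambda>t. LINT x|lborel. F (x + t *\<^sub>R v)) has_real_derivative (LINT x|lborel. F' x)) (at 0)"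
    by (simp only: has_derivative_inner_real_iff)
  moreover have "(LINT x|lborel. F (x + t *\<^sub>R v)) = (LINT x|lborel. F x)" for t
    using lborel_integral_translation[of F "t *\<^sub>R v"] by (simp add: add.commute)
  ultimately have "((\<lambda>t::real. LINT x|lborel. F x) has_real_derivative (LINT x|lborel. F' x)) (at 0)"
    by simp
  then show ?thesis
    using DERIV_unique DERIV_const by blast
qed

lemma has_derivative_imp_continuous_on_UNIV:
  fixes g :: "'a::real_normed_vector \<Rightarrow> 'b::real_normed_vector"
  assumes "\<And>x. (g has_derivative D x) (at x)"
  shows "continuous_on UNIV g"
  using assms by (meson continuous_at_imp_continuous_on has_derivative_continuous)

lemma has_real_derivative_along_line:
  fixes g :: "'a::real_inner \<Rightarrow> real"
  assumes "(g has_derivative (\<lambda>h. d \<bullet> h)) (at (x + t *\<^sub>R v))"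
  shows "((\<lambda>t. g (x + t *\<^sub>R v)) has_real_derivative d \<bullet> v) (at t)"
proof -
  have "((\<lambda>t. x + t *\<^sub>R v) has_derivative (\<lambda>h. h *\<^sub>R v)) (at t)"
    by (auto intro!: derivative_eq_intros)
  from has_derivative_compose[OF this assms] show ?thesis
    by (simp add: has_field_derivative_def mult.commute[of _ "d \<bullet> v"])
qed

text \<open>The product of the weight and \<open>g\<close> is Lipschitz with compact support, so its
  derivative along \<open>v\<close> has integral 0; the product rule splits that derivative into
  \<open>F1\<close> and \<open>F2\<close>.\<close>

lemma weighted_integral_by_parts:
  fixes g :: "'a::euclidean_space \<Rightarrow> real"
  assumes g: "\<And>x. (g has_derivative (\<lambda>h. G x \<bullet> h)) (at x)"
    and G: "continuous_on UNIV G" and "r > 0"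
  shows "(LINT x|lborel. max 0 (r\<^sup>2 - (norm x)\<^sup>2) * (G x \<bullet> v)) = 2 * (LINT x:ball 0 r|lborel. (x \<bullet> v) * g x)"
proof -
  define p where "p = (\<lambda>x::'a. max 0 (r\<^sup>2 - (norm x)\<^sup>2))"
  have p0: "p x = 0" if "r \<le> norm x" for x
    using that \<open>r > 0\<close> by (simp add: p_def power_mono)
  have p: "0 \<le> p x" "p x \<le> r\<^sup>2" for x by (auto simp: p_def)
  have cp: "continuous_on UNIV p" unfolding p_def by (intro continuous_intros)
  have cg: "continuous_on UNIV g" using g by (rule has_derivative_imp_continuous_on_UNIV)
  have [measurable]: "g \<in> borel_measurable borel" "G \<in> borel_measurable borel" "p \<in> borel_measurable borel"
    using cg G cp by (auto intro: borel_measurable_continuous_onI)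
  \<comment> \<open>Large enough to contain both x and x + t v when |t| < 1 and norm x <= r + norm
    v; farther out both points lie where the weight is 0.\<close>
  define R where "R = r + 2 * norm v"
  obtain B1 where B1: "\<And>x. norm x \<le> R \<Longrightarrow> norm (g x) \<le> B1" using bounded_on_cball[OF cg] by metis
  obtain B2 where B2: "\<And>x. norm x \<le> R \<Longrightarrow> norm (G x) \<le> B2" using bounded_on_cball[OF G] by metis
  define B where "B = max B1 B2"
  have R: "R > 0" using \<open>r > 0\<close> by (simp add: R_def add_pos_nonneg)
  have B: "\<bar>g x\<bar> \<le> B" "norm (G x) \<le> B" if "norm x \<le> R" for x
    using B1[OF that] B2[OF that] by (auto simp: B_def)
  have B0: "B \<ge> 0" using B(2)[of 0] R norm_ge_zero[of "G 0"] by (simp add: order_trans[OF norm_ge_zero])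
  define F where "F = (\<lambda>x. p x * g x)"
  define F1 where "F1 = (\<lambda>x. p x * (G x \<bullet> v))"
  define F2 where "F2 = (\<lambda>x. indicator (ball 0 r) x * (2 * ((x \<bullet> v) * g x)))"
  have bounds: "\<bar>G x \<bullet> v\<bar> \<le> B * norm v" if "norm x \<le> R" for x
    using Cauchy_Schwarz_ineq2[of "G x" v] mult_right_mono[OF B(2)[OF that], of "norm v"] by simp
  have rR: "norm x \<le> r \<Longrightarrow> norm x \<le> R" for x :: 'a
    unfolding R_def using norm_ge_zero[of v] by linarith
  have intF1: "integrable lborel F1" unfolding F1_def
  proof (rule integrable_vanishing_outside[where r = r and B = "r\<^sup>2 * (B * norm v)"])
    show "norm (p x * (G x \<bullet> v)) \<le> r\<^sup>2 * (B * norm v)" if "x \<in> cball 0 r" for x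
      unfolding norm_mult using p[of x] bounds[of x] rR[of x] that by (intro mult_mono) auto
  qed (use p0 in auto)
  have intF2: "integrable lborel F2" unfolding F2_def
  proof (rule integrable_vanishing_outside[where r = r and B = "2 * (R * norm v * B)"])
    show "norm (indicator (ball 0 r) x * (2 * ((x \<bullet> v) * g x))) \<le> 2 * (R * norm v * B)" if "x \<in> cball 0 r" for x
    proof -
      have "\<bar>x \<bullet> v\<bar> \<le> R * norm v"
        using Cauchy_Schwarz_ineq2[of x v] mult_right_mono[OF rR[of x], of "norm v"] that by simp
      then have "\<bar>x \<bullet> v\<bar> * \<bar>g x\<bar> \<le> R * norm v * B"
        using B[of x] rR[of x] that R by (intro mult_mono) auto
      then show ?thesis using R B0 by (auto simp: indicator_def abs_mult)
    qed
  qed (auto simp: indicator_def)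
  have "(LINT x|lborel. F1 x - F2 x) = 0"
  \<comment> \<open>The constant \<open>L\<close> follows the product rule: the weight is at most
    r^2 and \<open>g\<close> has Lipschitz constant \<open>B\<close>; |g| is at most
    \<open>B\<close> and the square of the norm has Lipschitz constant \<open>2 * R\<close> on the
    ball of radius \<open>R\<close>.\<close>
  proof (rule integral_directional_derivative_eq_0[where F = F and r = r and v = v
        and L = "r\<^sup>2 * (B * norm v) + B * (norm v * (2 * R))"])
    show "continuous_on UNIV F" unfolding F_def by (intro continuous_intros cp cg)
    show "F x = 0" if "norm x > r" for x using p0[of x] that by (simp add: F_def)
    show "integrable lborel (\<lambda>x. F1 x - F2 x)" using intF1 intF2 by simp
    show "\<bar>F (x + t *\<^sub>R v) - F x\<bar> \<le> (r\<^sup>2 * (B * norm v) + B * (norm v * (2 * R))) * \<bar>t\<bar>" if t: "\<bar>t\<bar> < 1" for x t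
    proof -
      let ?y = "x + t *\<^sub>R v"
      have tv: "norm (t *\<^sub>R v) \<le> norm v"
        using t mult_right_mono[of "\<bar>t\<bar>" 1 "norm v"] by simp
      show ?thesis
      proof (cases "norm x \<le> r + norm v")
        case True
        have xy: "norm x \<le> R" "norm ?y \<le> R"
          unfolding R_def using True tv norm_triangle_ineq[of x "t *\<^sub>R v"] norm_ge_zero[of v] by linarith+
        have "norm (g ?y - g x) \<le> B * norm (?y - x)"
        proof (rule differentiable_bound[where S = "cball 0 R" and f' = "\<lambda>x h. G x \<bullet> h"])
          show "(g has_derivative (\<bullet>) (G z)) (at z within cball 0 R)" for z
            using g by (rule has_derivative_at_withinI)
          show "onorm ((\<bullet>) (G z)) \<le> B" if "z \<in> cball 0 R" for z
            using B(2)[of z] that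
            by (intro onorm_le) (metis Cauchy_Schwarz_ineq2 mult_right_mono norm_ge_zero order_trans real_norm_def mem_cball_0)
        qed (use xy in auto)
        then have dg: "\<bar>g ?y - g x\<bar> \<le> B * norm v * \<bar>t\<bar>" by (simp add: ac_simps)
        have "\<bar>p ?y - p x\<bar> \<le> \<bar>(norm ?y)\<^sup>2 - (norm x)\<^sup>2\<bar>" unfolding p_def by linarith
        also have "\<dots> = \<bar>norm ?y - norm x\<bar> * \<bar>norm ?y + norm x\<bar>"
          by (simp only: abs_mult[symmetric]) (simp add: power2_eq_square algebra_simps)
        also have "\<dots> \<le> norm (?y - x) * (2 * R)"
          using xy norm_triangle_ineq3[of ?y x] by (intro mult_mono) auto
        finally have dp: "\<bar>p ?y - p x\<bar> \<le> norm v * (2 * R) * \<bar>t\<bar>" by (simp add: ac_simps)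
        have "\<bar>F ?y - F x\<bar> = \<bar>p ?y * (g ?y - g x) + g x * (p ?y - p x)\<bar>"
          by (simp add: F_def algebra_simps)
        also have "\<dots> \<le> p ?y * \<bar>g ?y - g x\<bar> + \<bar>g x\<bar> * \<bar>p ?y - p x\<bar>"
          using p[of ?y] abs_triangle_ineq[of "p ?y * (g ?y - g x)" "g x * (p ?y - p x)"] by (simp add: abs_mult)
        also have "\<dots> \<le> r\<^sup>2 * (B * norm v * \<bar>t\<bar>) + B * (norm v * (2 * R) * \<bar>t\<bar>)"
          using p[of ?y] dg dp B(1)[OF xy(1)] B0 by (intro add_mono mult_mono) auto
        finally show ?thesis by (simp add: algebra_simps)
      next
        case False
        then have "norm ?y \<ge> r" "norm x \<ge> r"
          using tv norm_ge_zero[of v] norm_triangle_ineq4[of ?y "t *\<^sub>R v"]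
          unfolding add_diff_cancel_right' by linarith+
        then show ?thesis using p0 B0 R by (simp add: F_def)
      qed
    qed
    show "AE x in lborel. ((\<lambda>t. F (x + t *\<^sub>R v)) has_real_derivative F1 x - F2 x) (at 0)"
      using AE_not_in_sphere[of "0::'a" r]
    proof eventually_elim
      case (elim x)
      have line: "isCont (\<lambda>t. norm (x + t *\<^sub>R v)) 0" by (intro continuous_intros)
      show ?case
      proof (cases "norm x < r")
        case True
        have dg: "((\<lambda>t. g (x + t *\<^sub>R v)) has_real_derivative G x \<bullet> v) (at 0)"
          using has_real_derivative_along_line[of g "G x" x 0 v] g[of x] by simp
        have "((\<lambda>t. r\<^sup>2 - (x + t *\<^sub>R v) \<bullet> (x + t *\<^sub>R v)) has_real_derivative - 2 * (x \<bullet> v)) (at 0)"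
          unfolding has_field_derivative_def
          by (auto intro!: derivative_eq_intros simp: inner_commute)
        from DERIV_mult[OF this dg]
        have der: "((\<lambda>t. (r\<^sup>2 - (x + t *\<^sub>R v) \<bullet> (x + t *\<^sub>R v)) * g (x + t *\<^sub>R v)) has_real_derivative F1 x - F2 x) (at 0)"
          by (rule DERIV_cong) (use True \<open>r > 0\<close> in \<open>simp add: F1_def F2_def p_def max_absorb2 power_mono algebra_simps dot_square_norm\<close>)
        have "\<forall>\<^sub>F t in at 0. norm (x + t *\<^sub>R v) < r"
          using line True unfolding isCont_def by (intro order_tendstoD) auto
        then have "\<forall>\<^sub>F t in nhds 0. norm (x + t *\<^sub>R v) < r"
          using True by (simp add: eventually_nhds_conv_at)
        then have ev: "\<forall>\<^sub>F t in nhds 0. (r\<^sup>2 - (x + t *\<^sub>R v) \<bullet> (x + t *\<^sub>R v)) * g (x + t *\<^sub>R v) = F (x + t *\<^sub>R v)"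
          by eventually_elim (simp add: F_def p_def max_absorb2 power_mono dot_square_norm)
        show ?thesis
          using der unfolding DERIV_cong_ev[OF refl ev refl] .
      next
        case False
        with elim have gt: "r < norm x" by auto
        have "\<forall>\<^sub>F t in at 0. norm (x + t *\<^sub>R v) > r"
          using line gt unfolding isCont_def by (intro order_tendstoD) auto
        then have "\<forall>\<^sub>F t in nhds 0. norm (x + t *\<^sub>R v) > r"
          using gt by (simp add: eventually_nhds_conv_at)
        then have ev: "\<forall>\<^sub>F t in nhds 0. 0 = F (x + t *\<^sub>R v)"
          by eventually_elim (simp add: F_def p0)
        have "F1 x - F2 x = 0" using gt p0[of x] by (simp add: F1_def F2_def)
        then have "((\<lambda>t. 0) has_real_derivative F1 x - F2 x) (at 0)" by simp
        then show ?thesis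
          unfolding DERIV_cong_ev[OF refl ev refl] .
      qed
    qed
  qed
  then have "(LINT x|lborel. F1 x) = (LINT x|lborel. F2 x)"
    using intF1 intF2 by simp
  also have "\<dots> = 2 * (LINT x:ball 0 r|lborel. (x \<bullet> v) * g x)"
    unfolding F2_def set_lebesgue_integral_def
    by (simp flip: integral_mult_right_zero add: mult.left_commute)
  finally show ?thesis by (simp add: F1_def p_def)
qed

text \<open>Both sides of the weighted identity \<open>weighted_integral_by_parts\<close>, summed over a basis, become the divergence theorem after differentiation in \<open>r\<close>.\<close>

theorem divergence_theorem_ball:
  fixes F :: "'a::euclidean_space \<Rightarrow> 'a" and r :: real
  assumes F: "\<And>i x. i \<in> Basis \<Longrightarrow> ((\<lambda>x. F x \<bullet> i) has_derivative (\<lambda>h. G i x \<bullet> h)) (at x)"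
    and G: "\<And>i. i \<in> Basis \<Longrightarrow> continuous_on UNIV (G i)" and "r > 0"
  shows "(LINT x:ball 0 r|lborel. (\<Sum>i\<in>Basis. G i x \<bullet> i))
    = DIM('a) * r ^ (DIM('a) - 1) * (\<integral>y. F (r *\<^sub>R y) \<bullet> y \<partial>cone_measure)"
proof -
  let ?div = "\<lambda>x. \<Sum>i\<in>Basis. G i x \<bullet> i"
  have cFi: "continuous_on UNIV (\<lambda>x. F x \<bullet> i)" if "i \<in> Basis" for i
    using F[OF that] by (rule has_derivative_imp_continuous_on_UNIV)
  have "continuous_on UNIV (\<lambda>x. \<Sum>i\<in>Basis. (F x \<bullet> i) *\<^sub>R i)"
    by (intro continuous_intros cFi)
  then have cF: "continuous_on UNIV F" by (simp add: euclidean_representation)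
  have cdiv: "continuous_on UNIV ?div" by (intro continuous_intros G)
  have weighted: "(LINT x|lborel. max 0 (\<rho>\<^sup>2 - (norm x)\<^sup>2) * ?div x) = 2 * (LINT x:ball 0 \<rho>|lborel. F x \<bullet> x)"
    if "\<rho> > 0" for \<rho>
  proof -
    have "integrable lborel (\<lambda>x. max 0 (\<rho>\<^sup>2 - (norm x)\<^sup>2) * (G i x \<bullet> i))" if i: "i \<in> Basis" for i
    proof -
      have c: "continuous_on UNIV (\<lambda>x. max 0 (\<rho>\<^sup>2 - (norm x)\<^sup>2) * (G i x \<bullet> i))"
        by (intro continuous_intros G i)
      obtain B where "\<And>x. norm x \<le> \<rho> \<Longrightarrow> norm (max 0 (\<rho>\<^sup>2 - (norm x)\<^sup>2) * (G i x \<bullet> i)) \<le> B"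
        using bounded_on_cball[OF c] by metis
      then show ?thesis
        using borel_measurable_continuous_onI[OF c] \<open>\<rho> > 0\<close>
        by (intro integrable_vanishing_outside[where r = \<rho> and B = B]) (auto simp: power_mono)
    qed
    then have "(LINT x|lborel. max 0 (\<rho>\<^sup>2 - (norm x)\<^sup>2) * ?div x)
        = (\<Sum>i\<in>Basis. LINT x|lborel. max 0 (\<rho>\<^sup>2 - (norm x)\<^sup>2) * (G i x \<bullet> i))"
      unfolding sum_distrib_left by (rule Bochner_Integration.integral_sum)
    also have "\<dots> = (\<Sum>i\<in>Basis. 2 * (LINT x:ball 0 \<rho>|lborel. (x \<bullet> i) * (F x \<bullet> i)))"
      using weighted_integral_by_parts[OF F G \<open>\<rho> > 0\<close>] by (intro sum.cong) auto
    also have "\<dots> = 2 * (LINT x:ball 0 \<rho>|lborel. (\<Sum>i\<in>Basis. (x \<bullet> i) * (F x \<bullet> i)))"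
    proof -
      have "set_integrable lborel (ball 0 \<rho>) (\<lambda>x. (x \<bullet> i) * (F x \<bullet> i))" if "i \<in> Basis" for i
        by (rule set_integrable_continuous[OF _ _ ball_subset_cball]) (auto intro!: continuous_intros cFi that)
      then show ?thesis
        unfolding set_integrable_def set_lebesgue_integral_def sum_distrib_left[symmetric] scaleR_sum_right
        by (subst Bochner_Integration.integral_sum) auto
    qed
    also have "(\<lambda>x. \<Sum>i\<in>Basis. (x \<bullet> i) * (F x \<bullet> i)) = (\<lambda>x. F x \<bullet> x)"
      by (rule ext, subst (3) euclidean_inner) (simp add: mult.commute)
    finally show ?thesis .
  qed
  have "((\<lambda>r. LINT x|lborel. max 0 (r\<^sup>2 - (norm x)\<^sup>2) * ?div x) has_real_derivative
      2 * (DIM('a) * r ^ (DIM('a) - 1) * (\<integral>y. F (r *\<^sub>R y) \<bullet> (r *\<^sub>R y) \<partial>cone_measure))) (at r)"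
  proof (rule has_field_derivative_transform_within_open[where S = "{0<..}"])
    show "((\<lambda>r. 2 * (LINT x:ball 0 r|lborel. F x \<bullet> x)) has_real_derivative
      2 * (DIM('a) * r ^ (DIM('a) - 1) * (\<integral>y. F (r *\<^sub>R y) \<bullet> (r *\<^sub>R y) \<partial>cone_measure))) (at r)"
      using cF \<open>r > 0\<close> by (intro DERIV_cmult ball_integral_has_derivative continuous_intros)
  qed (use weighted \<open>r > 0\<close> in auto)
  \<comment> \<open>One function of r, differentiated in two ways. The flux appears with F(r y)
    against r y, and this extra r cancels the one in the derivative of the weight.\<close>
  from DERIV_unique[OF this weighted_integral_has_derivative[OF cdiv \<open>r > 0\<close>]]
  have "2 * (DIM('a) * r ^ (DIM('a) - 1) * (r * (\<integral>y. F (r *\<^sub>R y) \<bullet> y \<partial>cone_measure)))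
      = 2 * r * (LINT x:ball 0 r|lborel. ?div x)" by simp
  then show ?thesis using \<open>r > 0\<close> by (simp add: ac_simps)
qed

section \<open>Harmonic functions\<close>

lemma gradient_eqI:
  assumes "(f has_derivative (\<lambda>h. g \<bullet> h)) (at x)"
  shows "gradient f x = g"
  unfolding gradient_def frechet_derivative_at[OF assms, symmetric]
  by (simp add: vec_eq_iff inner_axis)

lemma has_derivative_gradient:
  assumes "f differentiable (at x)"
  shows "(f has_derivative (\<lambda>h. gradient f x \<bullet> h)) (at x)"
proof -
  let ?D = "frechet_derivative f (at x)"
  have D: "(f has_derivative ?D) (at x)"
    using assms by (simp add: frechet_derivative_works)
  then interpret D: bounded_linear ?D by (rule has_derivative_bounded_linear)
  have "?D h = gradient f x \<bullet> h" for h
  proof -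
    have "?D h = ?D (\<Sum>i\<in>UNIV. h $ i *\<^sub>R axis i 1)"
      using basis_expansion[of h] by (simp add: scalar_mult_eq_scaleR)
    also have "\<dots> = (\<Sum>i\<in>UNIV. h $ i * ?D (axis i 1))"
      by (simp add: D.sum D.scaleR)
    finally show ?thesis by (simp add: gradient_def inner_vec_def mult.commute)
  qed
  then show ?thesis using D by (metis (no_types, lifting) ext)
qed

text \<open>Carries the gradient and the rows of the Hessian as explicit witnesses.
  \<open>gradient\<close> is total, so an equation about it says nothing about differentiability;
  with witnesses, closure properties of harmonic functions reduce to \<open>has_derivative\<close>
  rules.\<close>

definition harmonic_with :: "(real^'n \<Rightarrow> real) \<Rightarrow> (real^'n \<Rightarrow> real^'n) \<Rightarrow> ('n \<Rightarrow> real^'n \<Rightarrow> real^'n) \<Rightarrow> bool" where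
  "harmonic_with u G H \<longleftrightarrow>
     (\<forall>x. (u has_derivative (\<lambda>h. G x \<bullet> h)) (at x)) \<and>
     (\<forall>i x. ((\<lambda>y. G y $ i) has_derivative (\<lambda>h. H i x \<bullet> h)) (at x)) \<and>
     (\<forall>i. continuous_on UNIV (H i)) \<and> (\<forall>x. (\<Sum>i\<in>UNIV. H i x $ i) = 0)"

lemma harmonic_withD:
  assumes "harmonic_with u G H"
  shows "(u has_derivative (\<lambda>h. G x \<bullet> h)) (at x)"
    and "((\<lambda>y. G y $ i) has_derivative (\<lambda>h. H i x \<bullet> h)) (at x)"
    and "continuous_on UNIV (H i)" and "(\<Sum>i\<in>UNIV. H i x $ i) = 0"
    and "continuous_on UNIV u" and "continuous_on UNIV G"
proof -
  show 1: "(u has_derivative (\<lambda>h. G x \<bullet> h)) (at x)"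
    and 2: "((\<lambda>y. G y $ i) has_derivative (\<lambda>h. H i x \<bullet> h)) (at x)"
    and "continuous_on UNIV (H i)" "(\<Sum>i\<in>UNIV. H i x $ i) = 0" for x i
    using assms by (auto simp: harmonic_with_def)
  show "continuous_on UNIV u"
    using 1 by (rule has_derivative_imp_continuous_on_UNIV)
  have "continuous_on UNIV (\<lambda>x. \<chi> i. G x $ i)"
    by (intro continuous_on_vec_lambda has_derivative_imp_continuous_on_UNIV[OF 2])
  then show "continuous_on UNIV G" by simp
qed

lemma harmonic_imp_harmonic_with:
  assumes "harmonic u"
  shows "harmonic_with u (gradient u) (\<lambda>i. gradient (\<lambda>y. gradient u y $ i))"
proof -
  have "continuous_on UNIV (\<lambda>x. \<chi> j. second_partial u i j x)" for i
    using assms by (intro continuous_on_vec_lambda) (auto simp: harmonic_def C2_def)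
  then show ?thesis
    using assms unfolding harmonic_with_def harmonic_def C2_def laplacian_def
    by (auto simp: second_partial_def has_derivative_gradient)
qed

lemma harmonic_with_imp_harmonic:
  assumes "harmonic_with u G H"
  shows "harmonic u" and "gradient u = G"
proof -
  note D = harmonic_withD[OF assms]
  show G: "gradient u = G"
    using D(1) by (intro ext gradient_eqI)
  have H: "gradient (\<lambda>y. G y $ i) = H i" for i
    using D(2) by (intro ext gradient_eqI)
  show "harmonic u"
    unfolding harmonic_def C2_def laplacian_def second_partial_def G H
    using D by (auto simp: differentiable_def intro!: continuous_on_component)
qed

lemma harmonic_has_derivative:
  "harmonic u \<Longrightarrow> (u has_derivative (\<lambda>h. gradient u x \<bullet> h)) (at x)"
  using harmonic_withD(1)[OF harmonic_imp_harmonic_with] .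

lemma harmonic_continuous_on: "harmonic u \<Longrightarrow> continuous_on S u"
  using harmonic_withD(5)[OF harmonic_imp_harmonic_with] continuous_on_subset by blast

lemma harmonic_gradient_continuous_on: "harmonic u \<Longrightarrow> continuous_on S (gradient u)"
  using harmonic_withD(6)[OF harmonic_imp_harmonic_with] continuous_on_subset by blast

lemma harmonic_affine:
  assumes "harmonic u"
  shows "harmonic (\<lambda>x. u (a + c *\<^sub>R x))"
    and "gradient (\<lambda>x. u (a + c *\<^sub>R x)) = (\<lambda>x. c *\<^sub>R gradient u (a + c *\<^sub>R x))"
proof -
  let ?H = "\<lambda>i. gradient (\<lambda>y. gradient u y $ i)"
  note D = harmonic_withD[OF harmonic_imp_harmonic_with[OF assms]]
  have A: "((\<lambda>x. a + c *\<^sub>R x) has_derivative (\<lambda>h. c *\<^sub>R h)) (at x)" for x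
    by (auto intro!: derivative_eq_intros)
  have "harmonic_with (\<lambda>x. u (a + c *\<^sub>R x)) (\<lambda>x. c *\<^sub>R gradient u (a + c *\<^sub>R x))
    (\<lambda>i x. (c * c) *\<^sub>R ?H i (a + c *\<^sub>R x))"
    unfolding harmonic_with_def
  proof (intro conjI allI)
    show "((\<lambda>x. u (a + c *\<^sub>R x)) has_derivative (\<bullet>) (c *\<^sub>R gradient u (a + c *\<^sub>R x))) (at x)" for x
      by (rule has_derivative_eq_rhs[OF has_derivative_compose[OF A D(1)]]) (simp add: fun_eq_iff)
    show "((\<lambda>y. (c *\<^sub>R gradient u (a + c *\<^sub>R y)) $ i) has_derivative (\<bullet>) ((c * c) *\<^sub>R ?H i (a + c *\<^sub>R x))) (at x)" for i x
      unfolding vector_scaleR_component real_scaleR_def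
      by (rule has_derivative_eq_rhs[OF has_derivative_mult_right[OF has_derivative_compose[OF A D(2)]]]) (simp add: fun_eq_iff)
    show "continuous_on UNIV (\<lambda>x. (c * c) *\<^sub>R ?H i (a + c *\<^sub>R x))" for i
      by (intro continuous_intros continuous_on_compose2[OF D(3)]) auto
    show "(\<Sum>i\<in>UNIV. ((c * c) *\<^sub>R ?H i (a + c *\<^sub>R x)) $ i) = 0" for x
      using D(4)[of "a + c *\<^sub>R x"] by (simp flip: sum_distrib_left)
  qed
  from harmonic_with_imp_harmonic[OF this]
  show "harmonic (\<lambda>x. u (a + c *\<^sub>R x))"
    and "gradient (\<lambda>x. u (a + c *\<^sub>R x)) = (\<lambda>x. c *\<^sub>R gradient u (a + c *\<^sub>R x))" .
qed

lemma harmonic_scale: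
  assumes "harmonic u"
  shows "harmonic (\<lambda>x. u (c *\<^sub>R x))" and "gradient (\<lambda>x. u (c *\<^sub>R x)) = (\<lambda>x. c *\<^sub>R gradient u (c *\<^sub>R x))"
  using harmonic_affine[OF assms, of 0 c] by simp_all

lemma harmonic_linear_combination:
  assumes "harmonic v" "harmonic w"
  shows "harmonic (\<lambda>x. v x - c * w x)"
proof -
  note V = harmonic_withD[OF harmonic_imp_harmonic_with[OF assms(1)]]
  note W = harmonic_withD[OF harmonic_imp_harmonic_with[OF assms(2)]]
  have "harmonic_with (\<lambda>x. v x - c * w x) (\<lambda>x. gradient v x - c *\<^sub>R gradient w x)
    (\<lambda>i x. gradient (\<lambda>y. gradient v y $ i) x - c *\<^sub>R gradient (\<lambda>y. gradient w y $ i) x)"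
    unfolding harmonic_with_def
    by (auto intro!: derivative_eq_intros V W continuous_intros simp: inner_diff_left sum_subtractf V
        simp flip: sum_distrib_left)
  then show ?thesis by (rule harmonic_with_imp_harmonic)
qed

lemma harmonic_const: "harmonic (\<lambda>x. c)"
proof -
  have "harmonic_with (\<lambda>x::real^'n. c) (\<lambda>x. 0) (\<lambda>i x. 0)"
    by (auto simp: harmonic_with_def)
  then show ?thesis by (rule harmonic_with_imp_harmonic)
qed

section \<open>Green's identities on balls and the pairing of two radii\<close>

lemma divergence_theorem_ball_cart:
  fixes F :: "real^'n \<Rightarrow> real^'n" and r :: real
  assumes F: "\<And>i x. ((\<lambda>x. F x $ i) has_derivative (\<lambda>h. G i x \<bullet> h)) (at x)"
    and G: "\<And>i. continuous_on UNIV (G i)" and "r > 0"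
  shows "(LINT x:ball 0 r|lborel. (\<Sum>i\<in>UNIV. G i x $ i))
    = CARD('n) * r ^ (CARD('n) - 1) * (\<integral>y. F (r *\<^sub>R y) \<bullet> y \<partial>cone_measure)"
proof -
  have B: "(Basis :: (real^'n) set) = range (\<lambda>i. axis i 1)"
    by (auto simp: Basis_vec_def)
  have sum: "(\<Sum>b\<in>Basis. G (axis_index b) x \<bullet> b) = (\<Sum>i\<in>UNIV. G i x $ i)" for x
    unfolding B by (subst sum.reindex) (auto simp: inj_on_def axis_eq_axis inner_axis)
  have "(LINT x:ball 0 r|lborel. (\<Sum>b\<in>Basis. G (axis_index b) x \<bullet> b))
      = DIM(real^'n) * r ^ (DIM(real^'n) - 1) * (\<integral>y. F (r *\<^sub>R y) \<bullet> y \<partial>cone_measure)"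
    by (rule divergence_theorem_ball) (use assms in \<open>auto simp: B inner_axis\<close>)
  then show ?thesis by (simp add: sum)
qed

text \<open>The divergence theorem for the field \<open>v\<close> times \<open>gradient w\<close>;
  harmonicity of \<open>w\<close> removes the Laplacian term from its divergence.\<close>

lemma Green_first_identity:
  fixes v w :: "real^'n \<Rightarrow> real" and r :: real
  assumes "harmonic v" "harmonic w" "r > 0"
  shows "(LINT x:ball 0 r|lborel. gradient v x \<bullet> gradient w x)
    = CARD('n) * r ^ (CARD('n) - 1) * (\<integral>y. v (r *\<^sub>R y) * (gradient w (r *\<^sub>R y) \<bullet> y) \<partial>cone_measure)"
proof -
  let ?H = "\<lambda>i. gradient (\<lambda>y. gradient w y $ i)"
  let ?G = "\<lambda>i x. v x *\<^sub>R ?H i x + (gradient w x $ i) *\<^sub>R gradient v x"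
  note V = harmonic_withD[OF harmonic_imp_harmonic_with[OF assms(1)]]
  note W = harmonic_withD[OF harmonic_imp_harmonic_with[OF assms(2)]]
  have "(LINT x:ball 0 r|lborel. (\<Sum>i\<in>UNIV. ?G i x $ i))
    = CARD('n) * r ^ (CARD('n) - 1) * (\<integral>y. (v (r *\<^sub>R y) *\<^sub>R gradient w (r *\<^sub>R y)) \<bullet> y \<partial>cone_measure)"
  proof (rule divergence_theorem_ball_cart[OF _ _ \<open>r > 0\<close>])
    show "((\<lambda>x. (v x *\<^sub>R gradient w x) $ i) has_derivative (\<bullet>) (?G i x)) (at x)" for i x
      by (auto intro!: derivative_eq_intros V W simp: inner_add_left)
    show "continuous_on UNIV (?G i)" for i
      by (intro continuous_intros V W)
  qed
  moreover have "(\<Sum>i\<in>UNIV. ?G i x $ i) = gradient v x \<bullet> gradient w x" for x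
    by (simp add: sum.distrib sum_distrib_left[symmetric] W(4) inner_vec_def mult.commute)
  ultimately show ?thesis by simp
qed

text \<open>The energy side of the first identity is symmetric in \<open>v\<close> and
  \<open>w\<close>.\<close>

lemma Green_second_identity:
  fixes v w :: "real^'n \<Rightarrow> real" and r :: real
  assumes "harmonic v" "harmonic w" "r > 0"
  shows "(\<integral>y. v (r *\<^sub>R y) * (gradient w (r *\<^sub>R y) \<bullet> y) \<partial>cone_measure)
    = (\<integral>y. w (r *\<^sub>R y) * (gradient v (r *\<^sub>R y) \<bullet> y) \<partial>cone_measure)"
  using Green_first_identity[OF assms] Green_first_identity[OF assms(2,1,3)] \<open>r > 0\<close>
  by (simp add: inner_commute[of "gradient v _"])

definition sphere_pairing :: "(real^'n \<Rightarrow> real) \<Rightarrow> (real^'n \<Rightarrow> real) \<Rightarrow> real \<Rightarrow> real \<Rightarrow> real" where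
  "sphere_pairing v w r s = (\<integral>y. v (r *\<^sub>R y) * w (s *\<^sub>R y) \<partial>cone_measure)"

text \<open>The derivative in \<open>t\<close> of the pairing at the radii \<open>r e\<^sup>t\<close> and \<open>s e\<^sup>-\<^sup>t\<close> vanishes by Green's second
  identity on the unit sphere, applied to two rescalings of \<open>v\<close> and \<open>w\<close>.\<close>

lemma sphere_pairing_exp_const:
  assumes v: "harmonic v" and w: "harmonic w"
  shows "sphere_pairing v w (r * exp t) (s * exp (-t)) = sphere_pairing v w r s"
proof -
  define f where "f = (\<lambda>t y. v ((r * exp t) *\<^sub>R y) * w ((s * exp (-t)) *\<^sub>R y))"
  define f1 where "f1 = (\<lambda>t y. w ((s * exp (-t)) *\<^sub>R y) * (((r * exp t) *\<^sub>R gradient v ((r * exp t) *\<^sub>R y)) \<bullet> y))"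
  define f2 where "f2 = (\<lambda>t y. v ((r * exp t) *\<^sub>R y) * (((s * exp (-t)) *\<^sub>R gradient w ((s * exp (-t)) *\<^sub>R y)) \<bullet> y))"
  note cont = continuous_on_compose2[OF harmonic_continuous_on[OF v, of UNIV]]
    continuous_on_compose2[OF harmonic_continuous_on[OF w, of UNIV]]
    continuous_on_compose2[OF harmonic_gradient_continuous_on[OF v, of UNIV]]
    continuous_on_compose2[OF harmonic_gradient_continuous_on[OF w, of UNIV]]
  have c1: "continuous_on UNIV (\<lambda>(t, y). f1 t y)" and c2: "continuous_on UNIV (\<lambda>(t, y). f2 t y)"
    unfolding f1_def f2_def split_def by (intro continuous_intros cont; simp)+
  have "((\<lambda>t. \<integral>y. f t y \<partial>cone_measure) has_real_derivative 0) (at t)" for t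
  proof -
    have "((\<lambda>t. \<integral>y. f t y \<partial>cone_measure) has_derivative (\<lambda>h. (\<integral>y. f1 t y - f2 t y \<partial>cone_measure) \<bullet> h)) (at t)"
    proof (rule cone_measure.has_derivative_integral)
      show "continuous_on UNIV (f t)" for t
        unfolding f_def by (intro continuous_intros cont) auto
      show "continuous_on UNIV (\<lambda>(t, y). f1 t y - f2 t y)"
        using continuous_on_diff[OF c1 c2] by (simp add: split_def)
      show "((\<lambda>t. f t y) has_derivative (\<bullet>) (f1 t y - f2 t y)) (at t)" for t y
      proof -
        have a: "((\<lambda>t. v ((r * exp t) *\<^sub>R y)) has_derivative
            (\<lambda>h. gradient v ((r * exp t) *\<^sub>R y) \<bullet> ((r * exp t * h) *\<^sub>R y))) (at t)"
          by (rule has_derivative_compose[OF _ harmonic_has_derivative[OF v]])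
            (auto intro!: derivative_eq_intros)
        have b: "((\<lambda>t. w ((s * exp (-t)) *\<^sub>R y)) has_derivative
            (\<lambda>h. gradient w ((s * exp (-t)) *\<^sub>R y) \<bullet> ((- s * exp (-t) * h) *\<^sub>R y))) (at t)"
          by (rule has_derivative_compose[OF _ harmonic_has_derivative[OF w]])
            (auto intro!: derivative_eq_intros)
        show ?thesis
          unfolding f_def
          by (rule has_derivative_eq_rhs[OF has_derivative_mult[OF a b]])
            (auto simp: f1_def f2_def algebra_simps)
      qed
    qed
    moreover have "(\<integral>y. f1 t y - f2 t y \<partial>cone_measure) = 0"
    proof -
      have "(\<integral>y. f1 t y \<partial>cone_measure) = (\<integral>y. f2 t y \<partial>cone_measure)"
        using Green_second_identity[OF harmonic_scale(1)[OF w, of "s * exp (-t)"] harmonic_scale(1)[OF v, of "r * exp t"], of 1]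
        by (simp add: harmonic_scale(2)[OF v] harmonic_scale(2)[OF w] f1_def f2_def)
      then show ?thesis
        using cone_measure.integrable_continuous[OF cone_measure.continuous_section[OF c1]]
          cone_measure.integrable_continuous[OF cone_measure.continuous_section[OF c2]] by simp
    qed
    ultimately show ?thesis by (simp only: has_derivative_inner_real_iff)
  qed
  then have "(\<integral>y. f t y \<partial>cone_measure) = (\<integral>y. f 0 y \<partial>cone_measure)"
    by (intro DERIV_isconst_all) auto
  then show ?thesis by (simp add: f_def sphere_pairing_def)
qed

text \<open>Pairs of radii with the same product lie on one curve (r exp t, s exp (-t)); the
  parameter sought is t = ln (r' / r).\<close>

lemma sphere_pairing_eq:
  assumes "harmonic v" "harmonic w" and "r > 0" "r' > 0" "r * s = r' * s'"
  shows "sphere_pairing v w r s = sphere_pairing v w r' s'"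
proof -
  have "s' = s * exp (- ln (r' / r))" "r' = r * exp (ln (r' / r))"
    using assms by (auto simp: exp_minus field_simps)
  then show ?thesis
    using sphere_pairing_exp_const[OF assms(1,2), of r "ln (r' / r)" s] by simp
qed

lemma integral_cone_measure_const:
  "(\<integral>y. c \<partial>(cone_measure :: 'a::euclidean_space measure)) = unit_ball_vol (real (DIM('a))) * (c::real)"
  by (subst integral_cone_measure) (auto simp: set_lebesgue_integral_def content_ball)

lemma unit_ball_vol_pos: "unit_ball_vol (real n) > 0"
  by (simp add: unit_ball_vol_def)

section \<open>Mean values and regularity\<close>

lemma has_derivative_shift:
  assumes "(f has_derivative D) (at (z + y))"
  shows "((\<lambda>z. f (z + y)) has_derivative D) (at z)"
proof -
  have "((\<lambda>z. z + y) has_derivative (\<lambda>h. h)) (at z)"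
    by (auto intro!: derivative_eq_intros)
  from has_derivative_compose[OF this assms] show ?thesis .
qed

text \<open>The ball integral is constant in the radius, and rescaling it to the unit ball shows a
  factor \<open>\<rho> ^ DIM('a)\<close> that tends to 0 with the radius.\<close>

lemma ball_integral_eq_0:
  fixes f :: "'a::euclidean_space \<Rightarrow> real"
  assumes f: "continuous_on UNIV f" and zero: "\<And>r. r > 0 \<Longrightarrow> (\<integral>y. f (r *\<^sub>R y) \<partial>cone_measure) = 0" and "r > 0"
  shows "(LINT x:ball 0 r|lborel. f x) = 0"
proof -
  let ?b = "\<lambda>r. LINT x:ball 0 r|lborel. f x"
  have m [measurable]: "f \<in> borel_measurable borel"
    using f by (rule borel_measurable_continuous_onI)
  have "(?b has_real_derivative 0) (at \<rho>)" if "\<rho> > 0" for \<rho>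
    using ball_integral_has_derivative[OF f that] zero[OF that] by simp
  then have const: "?b \<rho> = ?b r" if "\<rho> > 0" for \<rho>
    by (intro DERIV_isconst3[of 0 "max \<rho> r + 1"]) (use that \<open>r > 0\<close> in auto)
  have "continuous_on UNIV (\<lambda>(\<rho>, y). f (\<rho> *\<^sub>R y))"
    unfolding split_def by (intro continuous_intros continuous_on_compose2[OF f]) auto
  then have "continuous_on UNIV (\<lambda>\<rho>. \<rho> ^ DIM('a) * (\<integral>y. f (\<rho> *\<^sub>R y) \<partial>ball_measure))"
    by (intro continuous_intros ball_measure.continuous_on_integral)
  then have "isCont (\<lambda>\<rho>. \<rho> ^ DIM('a) * (\<integral>y. f (\<rho> *\<^sub>R y) \<partial>ball_measure)) 0"
    by (simp add: continuous_on_eq_continuous_at)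
  then have "((\<lambda>\<rho>. \<rho> ^ DIM('a) * (\<integral>y. f (\<rho> *\<^sub>R y) \<partial>ball_measure)) \<longlongrightarrow> 0) (at_right 0)"
    by (auto simp: isCont_def filterlim_at_split power_0_left)
  moreover have "\<forall>\<^sub>F \<rho> in at_right 0. \<rho> ^ DIM('a) * (\<integral>y. f (\<rho> *\<^sub>R y) \<partial>ball_measure) = ?b r"
    using eventually_at_right_less[of "0::real"]
  proof eventually_elim
    case (elim \<rho>)
    show ?case
      using const[OF elim] ball_integral_scale[OF m elim] by (simp add: integral_ball_measure)
  qed
  ultimately have "((\<lambda>\<rho>::real. ?b r) \<longlongrightarrow> 0) (at_right 0)"
    by (rule Lim_transform_eventually)
  then show ?thesis
    by (rule tendsto_unique[OF trivial_limit_at_right_real tendsto_const])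
qed

text \<open>Pairing with the constant 1 makes the second radius irrelevant, so the equation between
  products no longer constrains the first: the sphere integral is constant in r, and its limit at 0
  gives the value at the centre.\<close>

lemma sphere_mean_value:
  fixes u :: "real^'n \<Rightarrow> real"
  assumes u: "harmonic u" and "r > 0"
  shows "(\<integral>y. u (r *\<^sub>R y) \<partial>cone_measure) = unit_ball_vol (CARD('n)) * u 0"
proof -
  let ?c = "\<lambda>r. \<integral>y. u (r *\<^sub>R y) \<partial>cone_measure"
  have const: "?c \<rho> = ?c r" if "\<rho> > 0" for \<rho>
    using sphere_pairing_eq[OF u harmonic_const[of 1] that \<open>r > 0\<close>, of 1 "\<rho> / r"] \<open>r > 0\<close>
    by (simp add: sphere_pairing_def)
  have "continuous_on UNIV (\<lambda>(\<rho>, y). u (\<rho> *\<^sub>R y))"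
    unfolding split_def by (intro continuous_intros continuous_on_compose2[OF harmonic_continuous_on[OF u, of UNIV]]) auto
  then have "continuous_on UNIV ?c"
    by (rule cone_measure.continuous_on_integral)
  then have "isCont ?c 0"
    by (simp add: continuous_on_eq_continuous_at)
  then have "(?c \<longlongrightarrow> ?c 0) (at_right 0)"
    by (auto simp: isCont_def filterlim_at_split)
  moreover have "\<forall>\<^sub>F \<rho> in at_right 0. ?c \<rho> = ?c r"
    using eventually_at_right_less[of "0::real"] by eventually_elim (rule const)
  ultimately have "((\<lambda>\<rho>::real. ?c r) \<longlongrightarrow> ?c 0) (at_right 0)"
    by (rule Lim_transform_eventually)
  then have "?c r = ?c 0"
    by (rule tendsto_unique[OF trivial_limit_at_right_real tendsto_const])
  then show ?thesis
    using integral_cone_measure_const[of "u 0", where 'a = "real^'n"] by simp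
qed

lemma ball_mean_value:
  fixes u :: "real^'n \<Rightarrow> real"
  assumes u: "harmonic u"
  shows "(\<integral>y. u (x + y) \<partial>ball_measure) = unit_ball_vol (CARD('n)) * u x"
proof -
  have v: "harmonic (\<lambda>y. u (x + 1 *\<^sub>R y) - u x * 1)"
    by (rule harmonic_linear_combination[OF harmonic_affine(1)[OF u] harmonic_const])
  have "(LINT y:ball 0 1|lborel. u (x + 1 *\<^sub>R y) - u x * 1) = 0"
    by (rule ball_integral_eq_0[OF harmonic_continuous_on[OF v]])
      (use sphere_mean_value[OF v] in auto)
  then have "(\<integral>y. u (x + y) - u x \<partial>ball_measure) = 0"
    by (subst integral_ball_measure)
      (use borel_measurable_continuous_onI[OF harmonic_continuous_on[OF v]] in auto)
  moreover have "integrable ball_measure (\<lambda>y. u (x + y))"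
    by (intro ball_measure.integrable_continuous continuous_on_compose2[OF harmonic_continuous_on[OF u, of UNIV]]
        continuous_intros) auto
  moreover have "(\<integral>y. u x \<partial>(ball_measure :: (real^'n) measure)) = unit_ball_vol (CARD('n)) * u x"
    by (subst integral_ball_measure) (auto simp: set_lebesgue_integral_def content_ball)
  ultimately show ?thesis by simp
qed

text \<open>A coordinate is the second function in Green's identity when one partial derivative is
  integrated: its gradient is a constant unit vector.\<close>

lemma harmonic_coordinate:
  fixes i :: "'n::finite"
  shows "harmonic (\<lambda>x. x $ i)" "gradient (\<lambda>x. x $ i) = (\<lambda>x. axis i 1)"
proof -
  have "harmonic_with (\<lambda>x::real^'n. x $ i) (\<lambda>x. axis i 1) (\<lambda>i x. 0)"
    unfolding harmonic_with_def
    using bounded_linear_imp_has_derivative[OF bounded_linear_vec_nth] by (auto simp: inner_axis'[abs_def] inner_zero_left[abs_def])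
  from harmonic_with_imp_harmonic[OF this]
  show "harmonic (\<lambda>x::real^'n. x $ i)" "gradient (\<lambda>x::real^'n. x $ i) = (\<lambda>x. axis i 1)" .
qed

text \<open>A harmonic function is only assumed to be \<open>C\<^sup>2\<close>. The right-hand side does not involve derivatives
  of \<open>u\<close>, so it shows that the partial derivatives are again \<open>C\<^sup>2\<close>.\<close>

lemma partial_derivative_eq_cone_integral:
  fixes u :: "real^'n \<Rightarrow> real"
  assumes u: "harmonic u"
  shows "unit_ball_vol (CARD('n)) * gradient u x $ i = CARD('n) * (\<integral>y. y $ i * u (x + y) \<partial>cone_measure)"
proof -
  let ?V = "unit_ball_vol (CARD('n))"
  note cont = continuous_on_compose2[OF harmonic_continuous_on[OF u, of UNIV]]
    continuous_on_compose2[OF harmonic_gradient_continuous_on[OF u, of UNIV]]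
  have "((\<lambda>z. \<integral>y. u (z + y) \<partial>ball_measure) has_derivative (\<lambda>h. (\<integral>y. gradient u (x + y) \<partial>ball_measure) \<bullet> h)) (at x)"
  proof (rule ball_measure.has_derivative_integral)
    show "continuous_on UNIV (\<lambda>y. u (z + y))" for z
      by (intro cont continuous_intros) auto
    show "((\<lambda>z. u (z + y)) has_derivative (\<bullet>) (gradient u (z + y))) (at z)" for z y
      by (intro has_derivative_shift harmonic_has_derivative u)
    show "continuous_on UNIV (\<lambda>(z, y). gradient u (z + y))"
      unfolding split_def by (intro cont continuous_intros) auto
  qed
  then have "((\<lambda>z. ?V * u z) has_derivative (\<lambda>h. (\<integral>y. gradient u (x + y) \<partial>ball_measure) \<bullet> h)) (at x)"
    by (simp add: ball_mean_value[OF u])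
  moreover have "((\<lambda>z. ?V * u z) has_derivative (\<lambda>h. (?V *\<^sub>R gradient u x) \<bullet> h)) (at x)"
    by (rule has_derivative_eq_rhs[OF has_derivative_mult_right[OF harmonic_has_derivative[OF u]]]) (simp add: fun_eq_iff)
  ultimately have G: "?V *\<^sub>R gradient u x = (\<integral>y. gradient u (x + y) \<partial>ball_measure)"
    using gradient_eqI by metis
  have c: "continuous_on UNIV (\<lambda>y. gradient u (x + y))"
    by (intro cont continuous_intros) auto
  have "?V * gradient u x $ i = (?V *\<^sub>R gradient u x) \<bullet> axis i 1"
    by (simp add: inner_axis)
  also have "\<dots> = (\<integral>y. gradient u (x + y) \<bullet> axis i 1 \<partial>ball_measure)"
    unfolding G by (rule integral_inner_left[symmetric]) (intro ball_measure.integrable_continuous c)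
  also have "\<dots> = (LINT y:ball 0 1|lborel. gradient u (x + y) \<bullet> axis i 1)"
    by (intro integral_ball_measure borel_measurable_continuous_onI continuous_intros c)
  also have "\<dots> = CARD('n) * (\<integral>y. u (x + y) * (axis i 1 \<bullet> y) \<partial>cone_measure)"
    using Green_first_identity[OF harmonic_affine(1)[OF u, of x 1] harmonic_coordinate(1)[of i], of 1]
    using harmonic_affine(2)[OF u, of x 1] by (simp add: harmonic_coordinate(2))
  finally show ?thesis by (simp add: inner_axis' mult.commute)
qed

text \<open>A superposition of translates of \<open>u\<close>. All derivatives fall on
  \<open>u\<close>, so continuity of the kernel \<open>k\<close> suffices.\<close>

lemma harmonic_cone_convolution:
  fixes u k :: "real^'n \<Rightarrow> real"
  assumes u: "harmonic u" and k: "continuous_on UNIV k"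
  shows "harmonic (\<lambda>x. \<integral>y. k y * u (x + y) \<partial>cone_measure)"
proof -
  let ?H = "\<lambda>i. gradient (\<lambda>y. gradient u y $ i)"
  note D = harmonic_withD[OF harmonic_imp_harmonic_with[OF u]]
  have k': "continuous_on S (\<lambda>z. k (f z))" if "continuous_on S f" for S and f :: "'c::topological_space \<Rightarrow> real^'n"
    by (rule continuous_on_compose2[OF k that]) simp
  note cont = continuous_on_compose2[OF D(3)] continuous_on_compose2[OF D(5)] continuous_on_compose2[OF D(6)] k' continuous_intros
  have der: "((\<lambda>z. \<integral>y. k y * f (z + y) \<partial>cone_measure) has_derivative
      (\<lambda>h. (\<integral>y. k y *\<^sub>R f' (x + y) \<partial>cone_measure) \<bullet> h)) (at x)"
    if f: "\<And>z. (f has_derivative (\<lambda>h. f' z \<bullet> h)) (at z)" and f': "continuous_on UNIV f'"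
    for f :: "real^'n \<Rightarrow> real" and f' x
  proof (rule cone_measure.has_derivative_integral)
    show "continuous_on UNIV (\<lambda>y. k y * f (z + y))" for z
      by (intro continuous_on_compose2[OF has_derivative_imp_continuous_on_UNIV[OF f]] cont) auto
    show "((\<lambda>z. k y * f (z + y)) has_derivative (\<bullet>) (k y *\<^sub>R f' (z + y))) (at z)" for z y
      by (rule has_derivative_eq_rhs[OF has_derivative_mult_right[OF has_derivative_shift[OF f]]]) (simp add: fun_eq_iff)
    show "continuous_on UNIV (\<lambda>(z, y). k y *\<^sub>R f' (z + y))"
      unfolding split_def by (intro continuous_on_compose2[OF f'] cont) auto
  qed
  have int: "integrable cone_measure (\<lambda>y. k y *\<^sub>R f (x + y))" if "continuous_on UNIV f" for f :: "real^'n \<Rightarrow> real^'n" and x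
    by (intro cone_measure.integrable_continuous continuous_on_compose2[OF that] cont) auto
  have comp: "(\<integral>y. k y *\<^sub>R f (x + y) \<partial>cone_measure) $ i = (\<integral>y. k y * f (x + y) $ i \<partial>cone_measure)"
    if "continuous_on UNIV f" for f :: "real^'n \<Rightarrow> real^'n" and x i
    using integral_bounded_linear[OF bounded_linear_vec_nth[of i] int[OF that, of x]] by simp
  have "harmonic_with (\<lambda>x. \<integral>y. k y * u (x + y) \<partial>cone_measure) (\<lambda>x. \<integral>y. k y *\<^sub>R gradient u (x + y) \<partial>cone_measure)
    (\<lambda>i x. \<integral>y. k y *\<^sub>R ?H i (x + y) \<partial>cone_measure)"
    unfolding harmonic_with_def comp[OF D(6)] comp[OF D(3)]
  proof (intro conjI allI der D)
    show "continuous_on UNIV (\<lambda>x. \<integral>y. k y *\<^sub>R ?H i (x + y) \<partial>cone_measure)" for i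
    proof (rule cone_measure.continuous_on_integral)
      show "continuous_on UNIV (\<lambda>(x, y). k y *\<^sub>R ?H i (x + y))"
        unfolding split_def by (intro cont) auto
    qed
    fix x
    have "integrable cone_measure (\<lambda>y. k y * ?H i (x + y) $ i)" for i
      by (intro cone_measure.integrable_continuous cont) auto
    then have "(\<Sum>i\<in>UNIV. \<integral>y. k y * ?H i (x + y) $ i \<partial>cone_measure) = (\<integral>y. (\<Sum>i\<in>UNIV. k y * ?H i (x + y) $ i) \<partial>cone_measure)"
      by (subst Bochner_Integration.integral_sum) auto
    also have "\<dots> = 0"
      by (simp add: D(4) flip: sum_distrib_left)
    finally show "(\<Sum>i\<in>UNIV. \<integral>y. k y * ?H i (x + y) $ i \<partial>cone_measure) = 0" .
  qed
  then show ?thesis by (rule harmonic_with_imp_harmonic)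
qed

lemma harmonic_partial_derivative:
  fixes u :: "real^'n \<Rightarrow> real"
  assumes u: "harmonic u"
  shows "harmonic (\<lambda>x. gradient u x $ i)"
proof -
  let ?V = "unit_ball_vol (CARD('n))"
  have "harmonic (\<lambda>x. 0 - (- (CARD('n) / ?V)) * (\<integral>y. y $ i * u (x + y) \<partial>cone_measure))"
    by (rule harmonic_linear_combination[OF harmonic_const harmonic_cone_convolution[OF u]]) (intro continuous_intros)
  moreover have V: "?V \<noteq> 0"
    using unit_ball_vol_pos[of "CARD('n)"] by linarith
  have "gradient u x $ i = 0 - (- (CARD('n) / ?V)) * (\<integral>y. y $ i * u (x + y) \<partial>cone_measure)" for x
    using partial_derivative_eq_cone_integral[OF u, of x i] V by (simp add: field_simps)
  ultimately show ?thesis by simp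
qed

section \<open>Midpoint log-convexity of spherical means\<close>

lemma continuous_AE_eq_0_imp_eq_0:
  fixes f :: "'a::euclidean_space \<Rightarrow> real"
  assumes f: "continuous_on UNIV f" and ae: "AE x in lborel. x \<in> S \<longrightarrow> f x = 0" and "open S" "x \<in> S"
  shows "f x = 0"
proof (rule ccontr)
  assume "f x \<noteq> 0"
  let ?T = "S \<inter> {x. f x \<noteq> 0}"
  have "open {x. f x \<noteq> 0}"
    using f by (intro open_Collect_neq continuous_on_const)
  then have "open ?T" using \<open>open S\<close> by auto
  then obtain e where e: "e > 0" "ball x e \<subseteq> ?T"
    using \<open>x \<in> S\<close> \<open>f x \<noteq> 0\<close> by (metis (mono_tags, lifting) IntI mem_Collect_eq open_contains_ball)
  have "emeasure lborel ?T = 0"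
    using ae \<open>open ?T\<close> by (subst (asm) AE_iff_measurable[OF _ refl]) (auto simp: Int_def)
  then have "emeasure lborel (ball x e) = 0"
    using emeasure_mono[OF e(2), of lborel] \<open>open ?T\<close> by simp
  then show False
    using e(1) unit_ball_vol_pos[of "DIM('a)"] by (simp add: emeasure_ball)
qed

definition sphere_square :: "(real^'n \<Rightarrow> real) \<Rightarrow> real \<Rightarrow> real" where
  "sphere_square u r = (\<integral>y. (u (r *\<^sub>R y))\<^sup>2 \<partial>cone_measure)"

lemma sphere_square_nonneg: "sphere_square u r \<ge> 0"
  by (simp add: sphere_square_def)

lemma sphere_pairing_eq_square:
  assumes "harmonic u" "r > 0" "s > 0"
  shows "sphere_pairing u u r s = sphere_square u (sqrt (r * s))"
  using sphere_pairing_eq[OF assms(1,1), of r "sqrt (r * s)" s "sqrt (r * s)"] assms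
  by (simp add: sphere_pairing_def sphere_square_def power2_eq_square)

text \<open>Expanding the square leaves a cross term at two radii, which the pairing turns into
  \<open>sphere_square\<close> at their geometric mean. The left side measures how far the traces of
  \<open>u\<close> on the two spheres are from proportional.\<close>

lemma sphere_square_difference:
  fixes u :: "real^'n \<Rightarrow> real"
  assumes u: "harmonic u" and "r > 0" "s > 0"
  shows "sphere_square (\<lambda>x. u (r *\<^sub>R x) - c * u (s *\<^sub>R x)) 1
    = sphere_square u r - 2 * c * sphere_square u (sqrt (r * s)) + c\<^sup>2 * sphere_square u s"
proof -
  note cont = continuous_on_compose2[OF harmonic_continuous_on[OF u, of UNIV]]
  have int: "integrable cone_measure (\<lambda>y. u (a *\<^sub>R y) * u (b *\<^sub>R y))" for a b
    by (intro cone_measure.integrable_continuous cont continuous_intros) auto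
  have "sphere_square (\<lambda>x. u (r *\<^sub>R x) - c * u (s *\<^sub>R x)) 1
      = (\<integral>y. u (r *\<^sub>R y) * u (r *\<^sub>R y) - 2 * c * (u (r *\<^sub>R y) * u (s *\<^sub>R y)) + c\<^sup>2 * (u (s *\<^sub>R y) * u (s *\<^sub>R y)) \<partial>cone_measure)"
    unfolding sphere_square_def by (intro Bochner_Integration.integral_cong) (auto simp: power2_eq_square algebra_simps)
  also have "\<dots> = sphere_square u r - 2 * c * sphere_pairing u u r s + c\<^sup>2 * sphere_square u s"
    using int by (simp add: sphere_square_def sphere_pairing_def power2_eq_square)
  finally show ?thesis using sphere_pairing_eq_square[OF assms] by simp
qed

lemma sphere_square_midpoint:
  assumes u: "harmonic u" and "r > 0" "s > 0"
  shows "(sphere_square u (sqrt (r * s)))\<^sup>2 \<le> sphere_square u r * sphere_square u s"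
proof -
  let ?a = "sphere_square u r" and ?b = "sphere_square u s" and ?p = "sphere_square u (sqrt (r * s))"
  have q: "0 \<le> ?a - 2 * c * ?p + c\<^sup>2 * ?b" for c
    using sphere_square_nonneg[of _ 1] unfolding sphere_square_difference[OF assms, symmetric] .
  show ?thesis
  \<comment> \<open>Vanishing on a sphere cannot be excluded yet: unique continuation is derived
    from this very inequality.\<close>
  proof (cases "?b = 0")
    case True
    have "?p = 0"
    proof (rule ccontr)
      assume "?p \<noteq> 0"
      \<comment> \<open>For \<open>?b = 0\<close> the quadratic is linear in c, and this c gives it
        the value -1.\<close>
      then show False using q[of "(?a + 1) / (2 * ?p)"] True by simp
    qed
    then show ?thesis using True by simp
  next
    case False
    then have "?b > 0" using sphere_square_nonneg[of u s] by simp
    then show ?thesis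
      using q[of "?p / ?b"] by (simp add: field_simps power2_eq_square)
  qed
qed

text \<open>Unique continuation: vanishing on one sphere propagates to all radii by the midpoint inequality.\<close>

lemma sphere_square_eq_0_imp:
  fixes u :: "real^'n \<Rightarrow> real"
  assumes u: "harmonic u" and "r > 0" and zero: "sphere_square u r = 0"
  shows "u x = 0"
proof -
  have "sphere_square u t = 0" if "t > 0" for t
    \<comment> \<open>The partner radius is chosen so that its geometric mean with r is t.\<close>
    using sphere_square_midpoint[OF u, of r "t\<^sup>2 / r"] that \<open>r > 0\<close> zero by simp
  moreover have c: "continuous_on UNIV (\<lambda>x. (u x)\<^sup>2)"
    by (intro continuous_intros harmonic_continuous_on u)
  moreover define R where "R = norm x + 1"
  ultimately have "(LINT x:ball 0 R|lborel. (u x)\<^sup>2) = 0"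
    by (intro ball_integral_eq_0) (auto simp: sphere_square_def add_nonneg_pos)
  moreover have "set_integrable lborel (ball 0 R) (\<lambda>x. (u x)\<^sup>2)"
    by (rule set_integrable_continuous[OF c _ ball_subset_cball]) simp
  ultimately have "AE x in lborel. indicator (ball 0 R) x *\<^sub>R (u x)\<^sup>2 = 0"
    unfolding set_integrable_def set_lebesgue_integral_def
    by (subst (asm) integral_nonneg_eq_0_iff_AE) auto
  then have "AE x in lborel. x \<in> ball 0 R \<longrightarrow> (u x)\<^sup>2 = 0"
    by eventually_elim (auto simp: indicator_def)
  from continuous_AE_eq_0_imp_eq_0[OF c this, of x] show ?thesis
    by (simp add: R_def)
qed

section \<open>The case of equality\<close>

text \<open>\<open>homogeneous_polynomial\<close> with its degree exposed: the partial derivatives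
  must be shown to share one degree before they can be assembled into \<open>u\<close>.\<close>

definition homogeneous_of_degree :: "nat \<Rightarrow> (real^'n \<Rightarrow> real) \<Rightarrow> bool" where
  "homogeneous_of_degree d p \<longleftrightarrow>
     (\<exists>c :: ('n \<Rightarrow> nat) \<Rightarrow> real. \<forall>x.
        p x = (\<Sum>\<alpha> | (\<Sum>i\<in>UNIV. \<alpha> i) = d. c \<alpha> * (\<Prod>i\<in>UNIV. (x $ i) ^ \<alpha> i)))"

lemma homogeneous_polynomial_iff: "homogeneous_polynomial p \<longleftrightarrow> (\<exists>d. homogeneous_of_degree d p)"
  by (simp add: homogeneous_polynomial_def homogeneous_of_degree_def)

section \<open>Algebra of homogeneous polynomials through their multi-indices\<close>

lemma finite_multi_indices: "finite {\<alpha> :: 'n::finite \<Rightarrow> nat. (\<Sum>i\<in>UNIV. \<alpha> i) = d}"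
proof (rule finite_subset)
  show "{\<alpha> :: 'n \<Rightarrow> nat. (\<Sum>i\<in>UNIV. \<alpha> i) = d} \<subseteq> PiE UNIV (\<lambda>_. {..d})"
    by (auto simp: PiE_def extensional_def intro!: member_le_sum)
qed (auto intro: finite_PiE)

lemma homogeneous_of_degree_zero: "homogeneous_of_degree d (\<lambda>x. 0)"
  unfolding homogeneous_of_degree_def by (intro exI[of _ "\<lambda>_. 0"]) simp

lemma homogeneous_of_degree_const: "homogeneous_of_degree 0 (\<lambda>x::real^'n. a)"
proof -
  have "{\<alpha> :: 'n::finite \<Rightarrow> nat. (\<Sum>i\<in>UNIV. \<alpha> i) = 0} = {\<lambda>_. 0}"
    by auto
  then show ?thesis
    unfolding homogeneous_of_degree_def by (intro exI[of _ "\<lambda>_. a"]) simp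
qed

lemma homogeneous_of_degree_cmult:
  assumes "homogeneous_of_degree d p"
  shows "homogeneous_of_degree d (\<lambda>x. a * p x)"
proof -
  obtain c where "\<And>x. p x = (\<Sum>\<alpha> | (\<Sum>i\<in>UNIV. \<alpha> i) = d. c \<alpha> * (\<Prod>i\<in>UNIV. (x $ i) ^ \<alpha> i))"
    using assms unfolding homogeneous_of_degree_def by blast
  then show ?thesis
    unfolding homogeneous_of_degree_def
    by (intro exI[of _ "\<lambda>\<alpha>. a * c \<alpha>"]) (simp add: sum_distrib_left mult.assoc)
qed

lemma homogeneous_of_degree_sum:
  assumes "\<And>k. k \<in> A \<Longrightarrow> homogeneous_of_degree d (p k)"
  shows "homogeneous_of_degree d (\<lambda>x. \<Sum>k\<in>A. p k x)"
proof -
  define P where "P = (\<lambda>k c. \<forall>x. p k x = (\<Sum>\<alpha> | (\<Sum>i\<in>UNIV. \<alpha> i) = d. c \<alpha> * (\<Prod>i\<in>UNIV. (x $ i) ^ \<alpha> i)))"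
  define c where "c = (\<lambda>k. SOME c. P k c)"
  have "P k (c k)" if "k \<in> A" for k
  proof -
    have "\<exists>c. P k c"
      using assms[OF that] unfolding homogeneous_of_degree_def P_def .
    then show ?thesis unfolding c_def by (rule someI_ex)
  qed
  then have c: "p k x = (\<Sum>\<alpha> | (\<Sum>i\<in>UNIV. \<alpha> i) = d. c k \<alpha> * (\<Prod>i\<in>UNIV. (x $ i) ^ \<alpha> i))" if "k \<in> A" for k x
    using that by (simp add: P_def)
  have "(\<Sum>k\<in>A. p k x) = (\<Sum>\<alpha> | (\<Sum>i\<in>UNIV. \<alpha> i) = d. (\<Sum>k\<in>A. c k \<alpha>) * (\<Prod>i\<in>UNIV. (x $ i) ^ \<alpha> i))" for x
  proof -
    have "(\<Sum>k\<in>A. p k x) = (\<Sum>k\<in>A. \<Sum>\<alpha> | (\<Sum>i\<in>UNIV. \<alpha> i) = d. c k \<alpha> * (\<Prod>i\<in>UNIV. (x $ i) ^ \<alpha> i))"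
      by (rule sum.cong[OF refl c])
    also have "\<dots> = (\<Sum>\<alpha> | (\<Sum>i\<in>UNIV. \<alpha> i) = d. \<Sum>k\<in>A. c k \<alpha> * (\<Prod>i\<in>UNIV. (x $ i) ^ \<alpha> i))"
      by (rule sum.swap)
    finally show ?thesis by (simp only: sum_distrib_right)
  qed
  then show ?thesis
    unfolding homogeneous_of_degree_def by (intro exI[of _ "\<lambda>\<alpha>. \<Sum>k\<in>A. c k \<alpha>"] allI)
qed

lemma homogeneous_of_degree_mult_coordinate:
  fixes p :: "real^'n \<Rightarrow> real"
  assumes "homogeneous_of_degree d p"
  shows "homogeneous_of_degree (Suc d) (\<lambda>x. x $ i * p x)"
proof -
  let ?M = "\<lambda>d. {\<alpha> :: 'n \<Rightarrow> nat. (\<Sum>i\<in>UNIV. \<alpha> i) = d}"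
  let ?f = "\<lambda>\<alpha> :: 'n \<Rightarrow> nat. \<alpha>(i := Suc (\<alpha> i))"
  obtain c where c: "\<And>x. p x = (\<Sum>\<alpha>\<in>?M d. c \<alpha> * (\<Prod>i\<in>UNIV. (x $ i) ^ \<alpha> i))"
    using assms unfolding homogeneous_of_degree_def by blast
  \<comment> \<open>The coefficients moved up by one in direction i; multi-indices with
    \<open>\<beta> i = 0\<close> are not reached by this shift and get 0.\<close>
  define c' where "c' = (\<lambda>\<beta>. if \<beta> i = 0 then 0 else c (\<beta>(i := \<beta> i - 1)))"
  have sum_f: "(\<Sum>j\<in>UNIV. ?f \<alpha> j) = Suc (\<Sum>j\<in>UNIV. \<alpha> j)" for \<alpha>
    using sum.remove[of UNIV i "?f \<alpha>"] sum.remove[of UNIV i \<alpha>] by simp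
  have prod_f: "(\<Prod>j\<in>UNIV. (x $ j) ^ ?f \<alpha> j) = x $ i * (\<Prod>j\<in>UNIV. (x $ j) ^ \<alpha> j)" for \<alpha> and x :: "real^'n"
    using prod.remove[of UNIV i "\<lambda>j. (x $ j) ^ ?f \<alpha> j"] prod.remove[of UNIV i "\<lambda>j. (x $ j) ^ \<alpha> j"] by simp
  have inj: "inj_on ?f (?M d)"
    by (rule inj_on_inverseI[where g = "\<lambda>\<beta>. \<beta>(i := \<beta> i - 1)"]) simp
  have image: "?f ` ?M d = {\<beta> \<in> ?M (Suc d). \<beta> i \<noteq> 0}"
  proof (intro equalityI subsetI)
    fix \<beta> assume \<beta>: "\<beta> \<in> {\<beta> \<in> ?M (Suc d). \<beta> i \<noteq> 0}"
    then have eq: "\<beta> = ?f (\<beta>(i := \<beta> i - 1))" by simp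
    then have "\<beta>(i := \<beta> i - 1) \<in> ?M d"
      using sum_f[of "\<beta>(i := \<beta> i - 1)"] \<beta> by simp
    then show "\<beta> \<in> ?f ` ?M d"
      by (rule image_eqI[where x = "\<beta>(i := \<beta> i - 1)", rotated]) (use eq in simp)
  qed (use sum_f in auto)
  have "x $ i * p x = (\<Sum>\<beta>\<in>?M (Suc d). c' \<beta> * (\<Prod>j\<in>UNIV. (x $ j) ^ \<beta> j))" for x
  proof -
    have "(\<Sum>\<beta>\<in>?M (Suc d). c' \<beta> * (\<Prod>j\<in>UNIV. (x $ j) ^ \<beta> j)) = (\<Sum>\<beta>\<in>?f ` ?M d. c' \<beta> * (\<Prod>j\<in>UNIV. (x $ j) ^ \<beta> j))"
      unfolding image by (rule sum.mono_neutral_right) (auto simp: finite_multi_indices c'_def)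
    also have "\<dots> = (\<Sum>\<alpha>\<in>?M d. c \<alpha> * (x $ i * (\<Prod>j\<in>UNIV. (x $ j) ^ \<alpha> j)))"
      unfolding sum.reindex[OF inj] o_def prod_f by (simp add: c'_def)
    also have "\<dots> = x $ i * p x"
      by (simp add: c sum_distrib_left mult.left_commute)
    finally show ?thesis by simp
  qed
  then show ?thesis unfolding homogeneous_of_degree_def by blast
qed

lemma homogeneous_of_degree_scale:
  assumes "homogeneous_of_degree d p"
  shows "p (t *\<^sub>R x) = t ^ d * p x"
proof -
  obtain c where c: "\<And>x. p x = (\<Sum>\<alpha> | (\<Sum>i\<in>UNIV. \<alpha> i) = d. c \<alpha> * (\<Prod>i\<in>UNIV. (x $ i) ^ \<alpha> i))"
    using assms unfolding homogeneous_of_degree_def by blast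
  show ?thesis
    unfolding c sum_distrib_left
    by (intro sum.cong) (auto simp: power_mult_distrib prod.distrib power_sum)
qed

text \<open>Iterating towards the origin, u x is C^j times the value of u at x / q^j, and continuity
  at 0 gives the limit: u 0 if C = 1, and 0 if C < 1.\<close>

lemma homogeneous_dilation_le_1:
  fixes u :: "real^'n \<Rightarrow> real"
  assumes u: "continuous_on UNIV u" and "1 < q" "0 < C" "C \<le> 1" and dil: "\<And>x. u (q *\<^sub>R x) = C * u x"
  shows "(\<forall>x. u x = 0) \<or> (C = 1 \<and> homogeneous_of_degree 0 u)"
proof -
  have iter: "u x = C ^ j * u (((1 / q) ^ j) *\<^sub>R x)" for x j
  proof (induction j)
    case (Suc j)
    have "u (((1 / q) ^ j) *\<^sub>R x) = C * u (((1 / q) ^ Suc j) *\<^sub>R x)"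
      using dil[of "((1 / q) ^ Suc j) *\<^sub>R x"] \<open>1 < q\<close> by simp
    then show ?case using Suc by simp
  qed simp
  have lim: "(\<lambda>j. u (((1 / q) ^ j) *\<^sub>R x)) \<longlonglongrightarrow> u 0" for x
  proof -
    have "(\<lambda>j. ((1 / q) ^ j) *\<^sub>R x) \<longlonglongrightarrow> 0 *\<^sub>R x"
      using \<open>1 < q\<close> by (intro tendsto_intros LIMSEQ_power_zero) auto
    then show ?thesis
      using u continuous_on_tendsto_compose[OF u, of "\<lambda>j. ((1 / q) ^ j) *\<^sub>R x" 0 sequentially] by simp
  qed
  show ?thesis
  proof (cases "C = 1")
    case True
    have "u x = u 0" for x
      using lim[of x] iter[of x] True by (simp add: LIMSEQ_const_iff)
    then have "u = (\<lambda>x. u 0)" by (intro ext)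
    then show ?thesis using homogeneous_of_degree_const True by metis
  next
    case False
    have C: "(\<lambda>j. C ^ j) \<longlonglongrightarrow> 0"
      using assms False by (intro LIMSEQ_power_zero) auto
    have "(\<lambda>j. u x) \<longlonglongrightarrow> 0 * u 0" for x
      using tendsto_mult[OF C lim[of x]] by (simp only: iter[symmetric])
    then have "u x = 0" for x
      by (simp add: LIMSEQ_const_iff)
    then show ?thesis by simp
  qed
qed

text \<open>Euler's formula: along the ray through x the derivative of u is t^d times a constant,
  and integrating from 0 to 1 produces the factor 1 / (d + 1).\<close>

lemma harmonic_eq_gradient_integral:
  fixes u :: "real^'n \<Rightarrow> real"
  assumes u: "harmonic u" and hom: "\<And>i. homogeneous_of_degree d (\<lambda>x. gradient u x $ i)"
  shows "u x = u 0 + (\<Sum>i\<in>UNIV. x $ i * gradient u x $ i) / Suc d"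
proof -
  have grad: "gradient u (t *\<^sub>R x) = t ^ d *\<^sub>R gradient u x" for t
    using homogeneous_of_degree_scale[OF hom] by (simp add: vec_eq_iff)
  have "((\<lambda>t. u (0 + t *\<^sub>R x)) has_real_derivative t ^ d * (gradient u x \<bullet> x)) (at t)" for t
    using has_real_derivative_along_line[OF harmonic_has_derivative[OF u], where x = 0 and t = t and v = x] by (simp add: grad)
  then have "((\<lambda>t. u (t *\<^sub>R x) - t ^ Suc d * (gradient u x \<bullet> x) / Suc d) has_real_derivative 0) (at t)" for t
    by (auto intro!: derivative_eq_intros simp del: power_Suc)
  from DERIV_isconst_all[OF allI[OF this], of 1 0]
  show ?thesis by (simp add: inner_vec_def mult.commute)
qed

text \<open>Induction on an exponent bounding the factor: each differentiation divides C by q, until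
  C <= 1. Recording C = q^d in the conclusion makes the degrees of the nonzero partial derivatives
  agree.\<close>

lemma harmonic_dilation_imp_homogeneous:
  fixes u :: "real^'n \<Rightarrow> real"
  assumes "harmonic u" "1 < q" "0 < C" "C \<le> q ^ k" "\<And>x. u (q *\<^sub>R x) = C * u x"
  shows "(\<forall>x. u x = 0) \<or> (\<exists>d. C = q ^ d \<and> homogeneous_of_degree d u)"
  using assms
proof (induction k arbitrary: u C)
  case 0
  then show ?case
    using homogeneous_dilation_le_1[OF harmonic_continuous_on, of u q C] by (metis power_0)
next
  case (Suc k)
  note u = \<open>harmonic u\<close>
  show ?case
  proof (cases "C \<le> 1")
    case True
    then show ?thesis
      using Suc.prems homogeneous_dilation_le_1[OF harmonic_continuous_on, of u q C] by (metis power_0)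
  next
    case False
    have u0: "u 0 = 0" using Suc.prems(5)[of 0] False by simp
    have "gradient u (q *\<^sub>R x) = (C / q) *\<^sub>R gradient u x" for x
    proof -
      have "((\<lambda>x. C * u x) has_derivative (\<lambda>h. (C *\<^sub>R gradient u x) \<bullet> h)) (at x)"
        by (rule has_derivative_eq_rhs[OF has_derivative_mult_right[OF harmonic_has_derivative[OF u]]])
          (simp add: fun_eq_iff)
      then have "gradient (\<lambda>x. u (q *\<^sub>R x)) x = C *\<^sub>R gradient u x"
        unfolding Suc.prems(5) by (rule gradient_eqI)
      then have "q *\<^sub>R gradient u (q *\<^sub>R x) = C *\<^sub>R gradient u x"
        by (simp add: harmonic_scale(2)[OF u])
      then have "(1 / q) *\<^sub>R q *\<^sub>R gradient u (q *\<^sub>R x) = (1 / q) *\<^sub>R C *\<^sub>R gradient u x" by simp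
      then show ?thesis using \<open>1 < q\<close> by simp
    qed
    then have IH: "(\<forall>x. gradient u x $ i = 0) \<or> (\<exists>d. C / q = q ^ d \<and> homogeneous_of_degree d (\<lambda>x. gradient u x $ i))" for i
      using Suc.prems by (intro Suc.IH harmonic_partial_derivative) (auto simp: field_simps)
    show ?thesis
    proof (cases "\<forall>i x. gradient u x $ i = 0")
      case True
      \<comment> \<open>A zero gradient counts as homogeneous of degree 0, so Euler's formula
        applies and gives u x = u 0.\<close>
      then have "u x = 0" for x
        using harmonic_eq_gradient_integral[OF u, of 0 x] u0 by (simp add: homogeneous_of_degree_zero)
      then show ?thesis by blast
    next
      case False
      then obtain d where d: "C / q = q ^ d" using IH by blast
      have hom: "homogeneous_of_degree d (\<lambda>x. gradient u x $ i)" for i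
        using IH[of i]
      proof
        assume "\<forall>x. gradient u x $ i = 0"
        then show ?thesis by (simp add: homogeneous_of_degree_zero)
      next
        assume "\<exists>d'. C / q = q ^ d' \<and> homogeneous_of_degree d' (\<lambda>x. gradient u x $ i)"
        \<comment> \<open>A power of q > 1 determines its exponent, hence d' = d.\<close>
        then show ?thesis using d \<open>1 < q\<close> by (auto simp: power_inject_exp)
      qed
      have "u = (\<lambda>x. inverse (real (Suc d)) * (\<Sum>i\<in>UNIV. x $ i * gradient u x $ i))"
        using harmonic_eq_gradient_integral[OF u hom] u0 by (intro ext) (simp add: divide_inverse mult.commute)
      moreover have "homogeneous_of_degree (Suc d) \<dots>"
        by (intro homogeneous_of_degree_cmult homogeneous_of_degree_sum homogeneous_of_degree_mult_coordinate hom)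
      moreover have "C = q ^ Suc d" using d \<open>1 < q\<close> by (simp add: field_simps)
      ultimately show ?thesis by metis
    qed
  qed
qed

text \<open>The zero function is a homogeneous polynomial, so the hypothesis and unique continuation
  together exclude vanishing on a sphere.\<close>

lemma sphere_square_pos:
  assumes "harmonic u" "\<not> homogeneous_polynomial u" "r > 0"
  shows "sphere_square u r > 0"
proof (rule ccontr)
  assume "\<not> sphere_square u r > 0"
  then have "u = (\<lambda>x. 0)"
    using sphere_square_eq_0_imp[OF assms(1,3)] sphere_square_nonneg[of u r] by (intro ext) simp
  then show False
    using assms(2) homogeneous_of_degree_zero by (auto simp: homogeneous_polynomial_iff)
qed

lemma sphere_square_midpoint_strict:
  fixes u :: "real^'n \<Rightarrow> real"
  assumes u: "harmonic u" and nh: "\<not> homogeneous_polynomial u" and "0 < r" "r < s"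
  shows "(sphere_square u (sqrt (r * s)))\<^sup>2 < sphere_square u r * sphere_square u s"
proof (rule ccontr)
  assume not_less: "\<not> ?thesis"
  let ?p = "sphere_square u (sqrt (r * s))"
  have s: "s > 0" using assms by simp
  have eq: "?p\<^sup>2 = sphere_square u r * sphere_square u s"
    using sphere_square_midpoint[OF u \<open>0 < r\<close> s] not_less by simp
  have pos: "sphere_square u s > 0" "?p > 0"
    using sphere_square_pos[OF u nh] \<open>0 < r\<close> s by auto
  \<comment> \<open>The minimiser of the quadratic in \<open>sphere_square_difference\<close>. Under
    equality the minimum is 0, so the difference of the two rescalings vanishes on the unit sphere
    and hence everywhere.\<close>
  define c where "c = ?p / sphere_square u s"
  have c: "c > 0" using pos by (simp add: c_def)
  have w: "harmonic (\<lambda>x. u (r *\<^sub>R x) - c * u (s *\<^sub>R x))"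
    by (rule harmonic_linear_combination[OF harmonic_scale(1)[OF u] harmonic_scale(1)[OF u]])
  have w0: "sphere_square (\<lambda>x. u (r *\<^sub>R x) - c * u (s *\<^sub>R x)) 1 = 0"
    unfolding sphere_square_difference[OF u \<open>0 < r\<close> s]
    using eq pos by (simp add: c_def field_simps power2_eq_square)
  have uc: "u (r *\<^sub>R x) - c * u (s *\<^sub>R x) = 0" for x
    by (rule sphere_square_eq_0_imp[OF w zero_less_one w0])
  define q where "q = s / r"
  have q: "q > 1" using assms by (simp add: q_def)
  have dil: "u (q *\<^sub>R x) = (1 / c) * u x" for x
    using uc[of "(1 / r) *\<^sub>R x"] c \<open>0 < r\<close> by (simp add: q_def field_simps)
  obtain k where "1 / c \<le> q ^ k"
    using real_arch_pow[OF q, of "1 / c"] less_imp_le by blast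
  then have "(\<forall>x. u x = 0) \<or> (\<exists>d. 1 / c = q ^ d \<and> homogeneous_of_degree d u)"
    using c by (intro harmonic_dilation_imp_homogeneous[OF u q _ _ dil]) auto
  then show False
  proof
    assume "\<forall>x. u x = 0"
    then show False using pos by (simp add: sphere_square_def)
  qed (use nh in \<open>auto simp: homogeneous_polynomial_iff\<close>)
qed

section \<open>The growth ratio\<close>

lemma sphere_square_continuous_on:
  assumes "harmonic u"
  shows "continuous_on S (sphere_square u)"
proof -
  have "continuous_on UNIV (\<lambda>(r, y). (u (r *\<^sub>R y))\<^sup>2)"
    unfolding split_def by (intro continuous_intros continuous_on_compose2[OF harmonic_continuous_on[OF assms, of UNIV]]) auto
  then have "continuous_on UNIV (sphere_square u)"
    unfolding sphere_square_def[abs_def] by (rule cone_measure.continuous_on_integral)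
  then show ?thesis by (rule continuous_on_subset) simp
qed

definition sphere_square_deriv :: "(real^'n \<Rightarrow> real) \<Rightarrow> real \<Rightarrow> real" where
  "sphere_square_deriv u r = (\<integral>y. 2 * (u (r *\<^sub>R y) * (gradient u (r *\<^sub>R y) \<bullet> y)) \<partial>cone_measure)"

lemma sphere_square_has_derivative:
  assumes u: "harmonic u"
  shows "(sphere_square u has_real_derivative sphere_square_deriv u r) (at r)"
    and "continuous_on UNIV (sphere_square_deriv u)"
proof -
  note cont = continuous_on_compose2[OF harmonic_continuous_on[OF u, of UNIV]]
    continuous_on_compose2[OF harmonic_gradient_continuous_on[OF u, of UNIV]]
  have c: "continuous_on UNIV (\<lambda>(r, y). 2 * (u (r *\<^sub>R y) * (gradient u (r *\<^sub>R y) \<bullet> y)))"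
    unfolding split_def by (intro cont continuous_intros) auto
  then show "continuous_on UNIV (sphere_square_deriv u)"
    unfolding sphere_square_deriv_def[abs_def] by (rule cone_measure.continuous_on_integral)
  have "((\<lambda>r. \<integral>y. (u (r *\<^sub>R y))\<^sup>2 \<partial>cone_measure) has_derivative (\<lambda>h. sphere_square_deriv u r \<bullet> h)) (at r)"
    unfolding sphere_square_deriv_def
  proof (rule cone_measure.has_derivative_integral[OF _ _ c])
    show "continuous_on UNIV (\<lambda>y. (u (r *\<^sub>R y))\<^sup>2)" for r
      by (intro cont continuous_intros) auto
    fix r y
    have "((\<lambda>r. u (0 + r *\<^sub>R y)) has_real_derivative gradient u (0 + r *\<^sub>R y) \<bullet> y) (at r)"
      by (intro has_real_derivative_along_line harmonic_has_derivative u)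
    then have "((\<lambda>r. u (r *\<^sub>R y)) has_real_derivative gradient u (r *\<^sub>R y) \<bullet> y) (at r)"
      by simp
    from DERIV_power[OF this, of 2]
    have "((\<lambda>r. (u (r *\<^sub>R y))\<^sup>2) has_real_derivative 2 * (u (r *\<^sub>R y) * (gradient u (r *\<^sub>R y) \<bullet> y))) (at r)"
      by (simp add: mult.commute)
    then show "((\<lambda>r. (u (r *\<^sub>R y))\<^sup>2) has_derivative (\<bullet>) (2 * (u (r *\<^sub>R y) * (gradient u (r *\<^sub>R y) \<bullet> y)))) (at r)"
      by (simp only: has_derivative_inner_real_iff)
  qed
  then show "(sphere_square u has_real_derivative sphere_square_deriv u r) (at r)"
    unfolding sphere_square_def[abs_def] by (simp only: has_derivative_inner_real_iff)
qed

text \<open>Green's first identity with both functions equal to \<open>u\<close>; the 2 on the left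
  is the one from differentiating a square.\<close>

lemma dirichlet_energy_ball:
  fixes u :: "real^'n \<Rightarrow> real" and r :: real
  assumes u: "harmonic u" and "r > 0"
  shows "2 * (LINT x:ball 0 r|lborel. (norm (gradient u x))\<^sup>2)
    = CARD('n) * r ^ (CARD('n) - 1) * sphere_square_deriv u r"
  using Green_first_identity[OF u u \<open>r > 0\<close>]
  by (simp add: sphere_square_deriv_def dot_square_norm)

section \<open>The surface measure expressed through \<open>cone_measure\<close>\<close>

lemma integral_scale_measure:
  fixes f :: "'a \<Rightarrow> real"
  assumes "f \<in> borel_measurable M" "c \<ge> 0"
  shows "(\<integral>x. f x \<partial>scale_measure (ennreal c) M) = c * (\<integral>x. f x \<partial>M)"
proof -
  have "scale_measure (ennreal c) M = density M (\<lambda>_. ennreal c)"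
    by (rule measure_eqI) (auto simp: emeasure_density_const)
  then show ?thesis
    using assms by (simp add: integral_density)
qed

lemma integral_surface_measure:
  fixes f :: "real^'n \<Rightarrow> real" and R :: real
  assumes [measurable]: "f \<in> borel_measurable borel" and "R > 0"
  shows "(\<integral>x. f x \<partial>surface_measure R) = CARD('n) * R ^ (CARD('n) - 1) * (\<integral>y. f (R *\<^sub>R y) \<partial>cone_measure)"
proof -
  let ?B = "ball 0 R - {0} :: (real^'n) set"
  have proj: "(R / norm x) *\<^sub>R x = R *\<^sub>R sgn x" for x :: "real^'n"
    by (simp add: sgn_div_norm divide_inverse)
  have mf: "f \<in> borel_measurable (restrict_space borel (sphere 0 R))"
    by (rule measurable_restrict_space1) measurable
  have mfs: "(\<lambda>x. f (R *\<^sub>R sgn x)) \<in> borel_measurable borel"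
    by measurable
  have "(\<integral>x. f x \<partial>surface_measure R) = CARD('n) / R * (\<integral>x. f ((R / norm x) *\<^sub>R x) \<partial>restrict_space lborel ?B)"
    unfolding surface_measure_def
    by (subst integral_scale_measure)
      (use mf \<open>R > 0\<close> in \<open>auto simp: integral_distr[OF radial_projection_measurable[OF \<open>R > 0\<close>] mf]\<close>)
  also have "(\<integral>x. f ((R / norm x) *\<^sub>R x) \<partial>restrict_space lborel ?B) = (LINT x|lborel. indicator ?B x *\<^sub>R f (R *\<^sub>R sgn x))"
    unfolding proj by (subst integral_restrict_space) auto
  also have "\<dots> = (LINT x:ball 0 R|lborel. f (R *\<^sub>R sgn x))"
    unfolding set_lebesgue_integral_def
  proof (rule integral_cong_AE)
    show "AE x in lborel. indicator ?B x *\<^sub>R f (R *\<^sub>R sgn x) = indicator (ball 0 R) x *\<^sub>R f (R *\<^sub>R sgn x)"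
      using AE_lborel_singleton[of "0 :: real^'n"] by eventually_elim (auto simp: indicator_def)
  qed (use mfs in \<open>auto intro!: borel_measurable_times borel_measurable_indicator\<close>)
  also have "\<dots> = R ^ CARD('n) * (\<integral>y. f (R *\<^sub>R y) \<partial>cone_measure)"
  proof -
    have "sgn (R *\<^sub>R x) = sgn x" for x :: "real^'n"
      using \<open>R > 0\<close> by (simp add: sgn_scaleR)
    then show ?thesis
      using ball_integral_scale[OF mfs \<open>R > 0\<close>] by (simp add: integral_cone_measure)
  qed
  also have "R ^ CARD('n) = R * R ^ (CARD('n) - 1)"
    using power_Suc[of R "CARD('n) - 1"] by simp
  finally show ?thesis using \<open>R > 0\<close> by simp
qed

lemma growth_ratio_eq:
  fixes u :: "real^'n \<Rightarrow> real" and R :: real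
  assumes n: "CARD('n) \<ge> 2" and u: "harmonic u" and nh: "\<not> homogeneous_polynomial u" and "R > 0"
  shows "growth_ratio u R = 1 - (real CARD('n) - 1) *
    integral {0..1} (\<lambda>s. s ^ (CARD('n) - 2) * (sphere_square u (s * R) / sphere_square u R))"
proof -
  let ?n = "CARD('n)" and ?m = "sphere_square u"
  let ?J = "integral {0..1} (\<lambda>s. s ^ (?n - 2) * (?m (s * R) / ?m R))"
  have mR: "?m R > 0" by (rule sphere_square_pos[OF u nh \<open>R > 0\<close>])
  have n1: "?n - 1 = Suc (?n - 2)" using n by simp
  \<comment> \<open>\<open>e\<close> is the energy on the ball of radius r, and \<open>a\<close> is
    set up so that \<open>a\<close> and \<open>2 / n * e\<close> are the two halves of the product
    rule for r^(n-1) m(r).\<close>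
  define e where "e = (\<lambda>r::real. ?n * r ^ (?n - 1) * sphere_square_deriv u r / 2)"
  define a where "a = (\<lambda>r::real. (real ?n - 1) * r ^ (?n - 2) * ?m r)"
  have cont_e: "continuous_on UNIV e"
    unfolding e_def by (intro continuous_intros sphere_square_has_derivative(2) u) auto
  have cont_a: "continuous_on UNIV a"
    unfolding a_def by (intro continuous_intros sphere_square_continuous_on u)
  have "(LINT r:{0..R}|lborel. (LINT x:ball 0 r|lborel. (norm (gradient u x))\<^sup>2)) = (LINT r:{0..R}|lborel. e r)"
  proof (rule set_lebesgue_integral_cong)
    show "\<forall>r. r \<in> {0..R} \<longrightarrow> (LINT x:ball 0 r|lborel. (norm (gradient u x))\<^sup>2) = e r"
    proof (intro allI impI)
      fix r assume "r \<in> {0..R}"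
      then consider "r = 0" | "r > 0" by fastforce
      then show "(LINT x:ball 0 r|lborel. (norm (gradient u x))\<^sup>2) = e r"
      proof cases
        case 1
        \<comment> \<open>At radius 0 the ball is empty, and \<open>e\<close> vanishes too because
          the exponent n - 1 is at least 1.\<close>
        then show ?thesis using n by (simp add: e_def set_lebesgue_integral_def)
      next
        case 2
        then show ?thesis using dirichlet_energy_ball[OF u 2] by (simp add: e_def)
      qed
    qed
  qed simp
  also have "\<dots> = integral {0..R} e"
    by (intro set_borel_integral_eq_integral(2) set_integrable_continuous[OF cont_e, where r = R]) auto
  finally have num: "(LINT r:{0..R}|lborel. (LINT x:ball 0 r|lborel. (norm (gradient u x))\<^sup>2)) = integral {0..R} e" .
  have "((\<lambda>r. a r + 2 / ?n * e r) has_integral (R ^ (?n - 1) * ?m R - 0 ^ (?n - 1) * ?m 0)) {0..R}"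
  proof (rule fundamental_theorem_of_calculus)
    fix r
    have "((\<lambda>r. r ^ (?n - 1) * ?m r) has_real_derivative a r + 2 / ?n * e r) (at r)"
      unfolding a_def e_def n1
      by (rule derivative_eq_intros sphere_square_has_derivative u refl)+ (use n in \<open>simp add: of_nat_diff algebra_simps\<close>)
    then show "((\<lambda>r. r ^ (?n - 1) * ?m r) has_vector_derivative a r + 2 / ?n * e r) (at r within {0..R})"
      unfolding has_real_derivative_iff_has_vector_derivative[symmetric] by (rule has_field_derivative_at_within)
  qed (use \<open>R > 0\<close> in simp)
  then have "integral {0..R} (\<lambda>r. a r + 2 / ?n * e r) = R ^ (?n - 1) * ?m R"
    using n by (simp add: integral_unique)
  moreover have "a integrable_on {0..R}" "(\<lambda>r. 2 / ?n * e r) integrable_on {0..R}"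
    by (intro integrable_continuous_interval continuous_intros continuous_on_subset[OF cont_a] continuous_on_subset[OF cont_e]; simp)+
  then have "integral {0..R} (\<lambda>r. a r + 2 / ?n * e r) = integral {0..R} a + 2 / ?n * integral {0..R} e"
    by (simp add: Henstock_Kurzweil_Integration.integral_add)
  moreover have "integral {0..R} a = (real ?n - 1) * R ^ (?n - 1) * ?m R * ?J"
  proof -
    have "(a has_integral integral {0..R} a) {0..R}"
      by (intro integrable_integral integrable_continuous_interval continuous_on_subset[OF cont_a]) simp
    \<comment> \<open>The substitution r = R s moves the integral to a fixed interval, so that R
      survives only in the ratio of sphere means.\<close>
    from has_integral_stretch_real[OF this, of R]
    have "((\<lambda>s. a (R * s)) has_integral integral {0..R} a / R) ((\<lambda>x. x / R) ` {0..R})"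
      using \<open>R > 0\<close> by simp
    moreover have "(\<lambda>x. x / R) ` {0..R} = {0..1}"
      using \<open>R > 0\<close> by (auto simp: image_divide_atLeastAtMost)
    ultimately have "integral {0..1} (\<lambda>s. a (R * s)) = integral {0..R} a / R"
      by (simp add: integral_unique)
    moreover have "a (R * s) = ((real ?n - 1) * R ^ (?n - 2) * ?m R) * (s ^ (?n - 2) * (?m (s * R) / ?m R))" for s
      using mR by (simp add: a_def power_mult_distrib mult.commute)
    ultimately have "((real ?n - 1) * R ^ (?n - 2) * ?m R) * ?J = integral {0..R} a / R"
      by (simp only: integral_mult_right)
    moreover have "integral {0..R} a = R * (integral {0..R} a / R)"
      using \<open>R > 0\<close> by simp
    moreover have "R ^ (?n - 1) = R * R ^ (?n - 2)"
      unfolding n1 by simp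
    ultimately show ?thesis by (simp only: ac_simps)
  qed
  ultimately have e: "2 * integral {0..R} e = ?n * (R ^ (?n - 1) * ?m R * (1 - (real ?n - 1) * ?J))"
    by (simp add: field_simps)
  have den: "(\<integral>x. (u x)\<^sup>2 \<partial>surface_measure R) = ?n * R ^ (?n - 1) * ?m R"
    unfolding sphere_square_def
    by (rule integral_surface_measure[OF borel_measurable_continuous_onI \<open>R > 0\<close>])
      (intro continuous_intros harmonic_continuous_on u)
  show ?thesis
    unfolding growth_ratio_def num e den using mR \<open>R > 0\<close> by simp
qed

text \<open>A maximum argument: with the chord subtracted, a positive maximum would have a leftmost
  point in the interior, and two symmetric neighbours contradict the midpoint inequality
  there.\<close>

lemma midpoint_convex_le_chord:
  fixes g :: "real \<Rightarrow> real"
  assumes g: "continuous_on {p..r} g" and mid: "\<And>x y. 2 * g ((x + y) / 2) \<le> g x + g y"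
    and "p < r" and x: "x \<in> {p..r}"
  shows "g x \<le> g p + (x - p) / (r - p) * (g r - g p)"
proof (rule ccontr)
  assume nle: "\<not> ?thesis"
  define k where "k = (g r - g p) / (r - p)"
  have k: "(r - p) * k = g r - g p" using \<open>p < r\<close> by (simp add: k_def)
  define D where "D = (\<lambda>x. g x - (g p + (x - p) * k))"
  have cD: "continuous_on {p..r} D"
    unfolding D_def by (intro continuous_intros g)
  have Dp: "D p = 0" and Dr: "D r = 0" using k by (auto simp: D_def)
  have mid': "2 * D ((x + y) / 2) \<le> D x + D y" for x y
  proof -
    have "D x + D y - 2 * D ((x + y) / 2) = g x + g y - 2 * g ((x + y) / 2)"
      unfolding D_def by (simp add: algebra_simps)
    then show ?thesis using mid[of x y] by linarith
  qed
  obtain c where c: "c \<in> {p..r}" "\<And>y. y \<in> {p..r} \<Longrightarrow> D y \<le> D c"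
    using continuous_attains_sup[OF compact_Icc _ cD] \<open>p < r\<close> by auto
  have "D c > 0" using c(2)[OF x] nle by (simp add: D_def k_def)
  define Z where "Z = {p..r} \<inter> D -` {D c}"
  have "closed Z" unfolding Z_def
    by (rule continuous_closed_preimage[OF cD]) auto
  moreover have "Z \<noteq> {}" "bdd_below Z" using c(1) by (auto simp: Z_def)
  ultimately have zZ: "Inf Z \<in> Z" by (rule closed_contains_Inf[rotated 2])
  define z where "z = Inf Z"
  have z: "z \<in> {p..r}" "D z = D c" using zZ by (auto simp: z_def Z_def)
  have "z \<noteq> p" "z \<noteq> r" using z(2) Dp Dr \<open>D c > 0\<close> by auto
  \<comment> \<open>The largest symmetric step that stays in the interval. The left neighbour lies
    before the leftmost maximum and is therefore strictly lower.\<close>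
  define d where "d = min (z - p) (r - z)"
  have d: "d > 0" "z - d \<in> {p..r}" "z + d \<in> {p..r}"
    using z(1) \<open>z \<noteq> p\<close> \<open>z \<noteq> r\<close> by (auto simp: d_def)
  have "z - d \<notin> Z"
    using cInf_lower[OF _ \<open>bdd_below Z\<close>, of "z - d"] d(1) by (auto simp: z_def)
  then have "D (z - d) < D c"
    using c(2)[OF d(2)] d(2) by (auto simp: Z_def)
  then show False
    using mid'[of "z - d" "z + d"] c(2)[OF d(3)] z(2) by simp
qed

text \<open>In the variable ln r the inner and outer radii have equal sums: ln R1 + ln (s R2) = ln
  (s R1) + ln R2. The chord over the outer pair, evaluated at both inner points, gives the
  cross-multiplied inequality.\<close>

lemma sphere_square_log_convex:
  fixes u :: "real^'n \<Rightarrow> real"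
  assumes u: "harmonic u" and nh: "\<not> homogeneous_polynomial u"
    and s: "0 < s" "s \<le> 1" and R: "0 < R1" "R1 \<le> R2"
  shows "sphere_square u (s * R2) / sphere_square u R2 \<le> sphere_square u (s * R1) / sphere_square u R1"
\<comment> \<open>If the outer radii coincide there is no chord, but then R1 = R2.\<close>
proof (cases "s * R1 = R2")
  case True
  have "s * R1 \<le> 1 * R1" using s R by (intro mult_right_mono) auto
  then have "R1 = R2" using True R by simp
  then show ?thesis by simp
next
  case False
  let ?m = "sphere_square u"
  have pos: "?m r > 0" if "r > 0" for r by (rule sphere_square_pos[OF u nh that])
  have pos': "?m (exp t) > 0" "?m (exp t) \<noteq> 0" for t
    using pos[of "exp t"] by auto
  define g where "g = (\<lambda>t. ln (?m (exp t)))"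
  have mid: "2 * g ((x + y) / 2) \<le> g x + g y" for x y
  proof -
    have "exp ((x + y) / 2) = sqrt (exp x * exp y)"
      by (intro real_sqrt_unique[symmetric]) (auto simp: power2_eq_square simp flip: exp_add)
    then have "(?m (exp ((x + y) / 2)))\<^sup>2 \<le> ?m (exp x) * ?m (exp y)"
      using sphere_square_midpoint[OF u, of "exp x" "exp y"] by simp
    then have "ln ((?m (exp ((x + y) / 2)))\<^sup>2) \<le> ln (?m (exp x) * ?m (exp y))"
      using pos' by (intro ln_mono) auto
    then show ?thesis
      using pos' by (simp add: g_def ln_mult_pos ln_realpow)
  qed
  have cg: "continuous_on S g" for S
    unfolding g_def
    by (intro continuous_intros continuous_on_compose2[OF sphere_square_continuous_on[OF u, of UNIV]])
      (use pos' in auto)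
  define p where "p = ln (s * R1)"
  define r where "r = ln R2"
  define x where "x = ln R1"
  define y where "y = ln (s * R2)"
  have sR: "s * R1 \<le> R1" "s * R2 \<le> R2" "s * R1 \<le> s * R2"
    using s R by (auto simp: mult_left_le_one_le)
  have R2: "R2 > 0" using R by simp
  have sum: "x + y = p + r" using s R R2 by (simp add: p_def r_def x_def y_def ln_mult)
  have "s * R1 < R2" using False sR R by linarith
  then have "p < r" using s R by (simp add: p_def r_def)
  have xr: "x \<in> {p..r}" "y \<in> {p..r}"
    using s R R2 sR by (auto simp: p_def r_def x_def y_def)
  note chord = midpoint_convex_le_chord[OF cg mid \<open>p < r\<close>]
  \<comment> \<open>By the equality of sums the chord weights of the two inner points add up to
    1.\<close>
  have "(x - p) / (r - p) * (g r - g p) + (y - p) / (r - p) * (g r - g p) = ((x - p) + (y - p)) / (r - p) * (g r - g p)"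
    by (simp only: add_divide_distrib distrib_right)
  also have "(x - p) + (y - p) = r - p"
    using sum by simp
  also have "(r - p) / (r - p) * (g r - g p) = g r - g p"
    using \<open>p < r\<close> by simp
  finally have "g x + g y \<le> g p + g r"
    using chord[OF xr(1)] chord[OF xr(2)] by linarith
  moreover have "g p = ln (?m (s * R1))" "g r = ln (?m R2)" "g x = ln (?m R1)" "g y = ln (?m (s * R2))"
    using s R R2 by (simp_all add: g_def p_def r_def x_def y_def)
  ultimately have "ln (?m R1 * ?m (s * R2)) \<le> ln (?m (s * R1) * ?m R2)"
    using pos s R R2 by (simp add: ln_mult_pos)
  then have "?m R1 * ?m (s * R2) \<le> ?m (s * R1) * ?m R2"
    using pos s R R2 by (subst (asm) ln_le_cancel_iff) auto
  then show ?thesis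
    using pos[OF \<open>0 < R1\<close>] pos[OF R2] by (simp add: field_simps)
qed

theorem theorem24:
  fixes u :: "real ^ 'n \<Rightarrow> real"
  assumes "CARD('n) \<ge> 2"
    and "harmonic u"
    and "\<not> (homogeneous_polynomial u \<and> harmonic u)"
  shows "strict_mono_on {0<..} (growth_ratio u)"
proof (rule strict_mono_onI)
  fix R1 R2 :: real
  assume "R1 \<in> {0<..}" "R2 \<in> {0<..}" and less: "R1 < R2"
  then have R: "R1 > 0" "R2 > 0" by auto
  note u = assms(2)
  have nh: "\<not> homogeneous_polynomial u" using assms(2,3) by simp
  let ?m = "sphere_square u"
  have pos: "?m r > 0" if "r > 0" for r by (rule sphere_square_pos[OF u nh that])
  define J where "J = (\<lambda>R s. s ^ (CARD('n) - 2) * (?m (s * R) / ?m R))"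
  have cont: "continuous_on S (J R)" if "R > 0" for S R
    unfolding J_def
    by (intro continuous_intros continuous_on_compose2[OF sphere_square_continuous_on[OF u, of UNIV]])
      (use pos[OF that] in auto)
  define f where "f = (\<lambda>s. J R1 s - J R2 s)"
  have cf: "continuous_on {0..1} f"
    unfolding f_def by (intro continuous_intros cont R)
  have pos_f: "f s \<ge> 0" if "s \<in> {0<..1}" for s
  proof -
    have "J R2 s \<le> J R1 s"
      unfolding J_def using that R less by (intro mult_left_mono sphere_square_log_convex[OF u nh]) auto
    then show ?thesis by (simp add: f_def)
  qed
  \<comment> \<open>Log-convexity covers only s > 0, and for n = 2 the power s^(n-2) is 1 at s = 0,
    so the sign there is obtained as a limit from the right.\<close>
  have "f 0 \<ge> 0"
  proof (rule tendsto_lowerbound[where F = "at_right 0"])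
    show "(f \<longlongrightarrow> f 0) (at_right 0)"
      using cf by (auto simp: continuous_on_Icc_at_rightD)
    show "\<forall>\<^sub>F s in at_right 0. 0 \<le> f s"
      using eventually_at_right_real[of 0 1] by (auto elim!: eventually_mono intro!: pos_f)
  qed simp
  then have nonneg: "f s \<ge> 0" if "s \<in> {0..1}" for s
    using pos_f[of s] that by (cases "s = 0") auto
  \<comment> \<open>At s = q the four radii collapse to the geometric progression q R1, R1, R2,
    since q R2 = R1; the strict midpoint inequality applies exactly to these.\<close>
  define q where "q = R1 / R2"
  have q: "0 < q" "q < 1" using R less by (auto simp: q_def)
  have "f q > 0"
  proof -
    have "q * R1 < R2" using q R less by (smt (verit) mult_less_cancel_right2)
    from sphere_square_midpoint_strict[OF u nh _ this]
    have "(?m (sqrt (q * R1 * R2)))\<^sup>2 < ?m (q * R1) * ?m R2" using q R by simp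
    moreover have "sqrt (q * R1 * R2) = R1" using R by (simp add: q_def)
    ultimately have "?m (q * R2) / ?m R2 < ?m (q * R1) / ?m R1"
      using pos R by (simp add: q_def field_simps power2_eq_square)
    then have "J R2 q < J R1 q"
      unfolding J_def using q by (intro mult_strict_left_mono) auto
    then show ?thesis by (simp add: f_def)
  qed
  \<comment> \<open>A continuous nonnegative integrand with one positive value cannot have integral
    0.\<close>
  then have "integral {0..1} f \<noteq> 0"
    using integral_eq_0_iff[OF cf _ nonneg] q by auto
  moreover have "integral {0..1} f \<ge> 0"
    using cf nonneg by (intro integral_nonneg integrable_continuous_interval) auto
  moreover have "integral {0..1} f = integral {0..1} (J R1) - integral {0..1} (J R2)"
    unfolding f_def by (intro integral_diff integrable_continuous_interval cont R)
  ultimately have "(real CARD('n) - 1) * integral {0..1} (J R2) < (real CARD('n) - 1) * integral {0..1} (J R1)"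
    using assms(1) by (intro mult_strict_left_mono) auto
  moreover have "growth_ratio u R = 1 - (real CARD('n) - 1) * integral {0..1} (J R)" if "R > 0" for R
    unfolding J_def by (rule growth_ratio_eq[OF assms(1) u nh that])
  ultimately show "growth_ratio u R1 < growth_ratio u R2"
    using R by simp
qed

end
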